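(* Let $\Sigma$ be a finite alphabet, let $X \subset \Sigma^{\mathbb{N}}$ be a mixing sofic shift with positive entropy, and let $K$ be an abstract simplicial complex. Then there exists a sofic shift $Y \subset X$ such that $\tilde Y$, equipped with the Besicovitch topology, is homotopy equivalent to (the geometric realization of) $K$.
   Context: Subshifts here are one-sided: a subshift is a subset of $\Sigma^{\mathbb{N}}$ that is closed in the product (Cantor) topology and shift-invariant, where the shift is $\sigma(x)_i = x_{i+1}$. A sofic shift is a subshift presented by a finite labeled graph. A sofic shift $X$ is mixing if it is nonempty and there is $m$ such that for all words $u,v$ occurring in $X$ and all $n\ge m$ there is a word $w$ of length $n$ such that $uwv$ occurs in $X$. The Besicovitch topology on $\Sigma^{\mathbb{N}}$ is given by the pseudometric $d_B(x,y)=\limsup_{n\to\infty} \frac{1}{n+1}|\{i\in[0,n] : x_i\neq y_i\}|$. For $Y \subset \Sigma^{\mathbb{N}}$, $\tilde Y = \{z \in \Sigma^{\mathbb{N}} : \exists y \in Y,\ d_B(y,z)=0\}$. An abstract simplicial complex is a collection $K \subset 2^V$ of subsets of a finite set $V$ that is closed under taking subsets; its geometric realization is obtained by mapping $V$ via $f$ to linearly independent points of $\mathbb{R}^{|V|}$ and taking the union of the convex hulls of $f(T)$ for $T\in K$. Two (not necessarily Hausdorff) topological spaces $A,B$ are homotopy equivalent if there are continuous $f:A\to B$, $g:B\to A$ with $g\circ f$ homotopic to $\mathrm{id}_A$ and $f\circ g$ homotopic to $\mathrm{id}_B$. *)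

theory Defs
  imports "HOL-Analysis.Analysis" "Graph_Theory.Digraph"
begin

section \<open>One-sided subshifts\<close>

definition shift :: "(nat \<Rightarrow> 'a) \<Rightarrow> (nat \<Rightarrow> 'a)" where
  "shift x = (\<lambda>i. x (Suc i))"

definition cantor_topology :: "(nat \<Rightarrow> 'a) topology" where
  "cantor_topology = product_topology (\<lambda>_. discrete_topology UNIV) UNIV"

definition subshift :: "(nat \<Rightarrow> 'a) set \<Rightarrow> bool" where
  "subshift X \<longleftrightarrow> closedin cantor_topology X \<and> shift ` X \<subseteq> X"

text \<open>The label sequences of all one-way infinite directed walks in the graph \<open>G\<close>, whose arcs
  are labeled by \<open>l\<close>.\<close>

definition presented_by :: "('v, 'e) pre_digraph \<Rightarrow> ('e \<Rightarrow> 'a) \<Rightarrow> (nat \<Rightarrow> 'a) set" where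
  "presented_by G l = {x. \<exists>p :: nat \<Rightarrow> 'e.
     \<forall>i. p i \<in> arcs G \<and> head G (p i) = tail G (p (Suc i)) \<and> x i = l (p i)}"

text \<open>Loops and parallel arcs are allowed, and so is the null graph: the empty shift is sofic.
  As the graphs are finite, taking natural numbers as vertices and arcs is no restriction.\<close>

definition sofic_shift :: "(nat \<Rightarrow> 'a) set \<Rightarrow> bool" where
  "sofic_shift X \<longleftrightarrow> subshift X \<and>
     (\<exists>(G :: (nat, nat) pre_digraph) l. fin_digraph G \<and> X = presented_by G l)"

definition occurs_in :: "'a list \<Rightarrow> (nat \<Rightarrow> 'a) set \<Rightarrow> bool" where
  "occurs_in w X \<longleftrightarrow> (\<exists>x\<in>X. \<exists>i. w = map x [i..<i + length w])"

definition mixing :: "(nat \<Rightarrow> 'a) set \<Rightarrow> bool" where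
  "mixing X \<longleftrightarrow> X \<noteq> {} \<and>
     (\<exists>m. \<forall>u v. occurs_in u X \<longrightarrow> occurs_in v X \<longrightarrow>
        (\<forall>n\<ge>m. \<exists>w. length w = n \<and> occurs_in (u @ w @ v) X))"

text \<open>Topological entropy. The limit exists for every nonempty subshift over a finite alphabet,
  because the logarithm of the number of words of length \<open>n\<close> is subadditive in \<open>n\<close>.\<close>

definition entropy :: "(nat \<Rightarrow> 'a) set \<Rightarrow> real" where
  "entropy X = lim (\<lambda>n. ln (real (card {w. length w = n \<and> occurs_in w X})) / real n)"


section \<open>The Besicovitch topology\<close>

definition besicovitch_dist :: "(nat \<Rightarrow> 'a) \<Rightarrow> (nat \<Rightarrow> 'a) \<Rightarrow> ereal" where
  "besicovitch_dist x y =
     limsup (\<lambda>n. ereal (real (card {i. i \<le> n \<and> x i \<noteq> y i}) / real (n + 1)))"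

text \<open>\<^const>\<open>besicovitch_dist\<close> is only a pseudometric, so the library's metric spaces do
  not apply.\<close>

definition besicovitch_topology :: "(nat \<Rightarrow> 'a) topology" where
  "besicovitch_topology =
     topology (\<lambda>U. \<forall>x\<in>U. \<exists>e>0. {y. besicovitch_dist x y < e} \<subseteq> U)"

lemma openin_besicovitch_topology:
  "openin besicovitch_topology U \<longleftrightarrow> (\<forall>x\<in>U. \<exists>e>0. {y. besicovitch_dist x y < e} \<subseteq> U)"
proof -
  have "istopology (\<lambda>U :: (nat \<Rightarrow> 'a) set. \<forall>x\<in>U. \<exists>e>0. {y. besicovitch_dist x y < e} \<subseteq> U)"
    unfolding istopology_def
  proof (intro conjI allI impI ballI)
    fix S T :: "(nat \<Rightarrow> 'a) set" and x
    assume S: "\<forall>x\<in>S. \<exists>e>0. {y. besicovitch_dist x y < e} \<subseteq> S"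
      and T: "\<forall>x\<in>T. \<exists>e>0. {y. besicovitch_dist x y < e} \<subseteq> T"
      and x: "x \<in> S \<inter> T"
    obtain d where d: "d > 0" "{y. besicovitch_dist x y < d} \<subseteq> S"
      using S x by blast
    obtain e where e: "e > 0" "{y. besicovitch_dist x y < e} \<subseteq> T"
      using T x by blast
    have "min d e > 0" "{y. besicovitch_dist x y < min d e} \<subseteq> S \<inter> T"
      using d e by auto
    then show "\<exists>e>0. {y. besicovitch_dist x y < e} \<subseteq> S \<inter> T"
      by blast
  next
    fix \<K> :: "(nat \<Rightarrow> 'a) set set" and x
    assume K: "\<forall>S\<in>\<K>. \<forall>x\<in>S. \<exists>e>0. {y. besicovitch_dist x y < e} \<subseteq> S"
      and x: "x \<in> \<Union>\<K>"
    from x obtain S where S: "S \<in> \<K>" "x \<in> S" by blast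
    with K obtain e where "e > 0" "{y. besicovitch_dist x y < e} \<subseteq> S" by blast
    then show "\<exists>e>0. {y. besicovitch_dist x y < e} \<subseteq> \<Union>\<K>"
      using S by blast
  qed
  then show ?thesis
    unfolding besicovitch_topology_def by (simp add: topology_inverse')
qed

lemma topspace_besicovitch_topology [simp]: "topspace besicovitch_topology = UNIV"
proof -
  have "openin besicovitch_topology (UNIV :: (nat \<Rightarrow> 'a) set)"
    unfolding openin_besicovitch_topology by (auto intro: exI[of _ 1])
  then show ?thesis
    using openin_subset by blast
qed

definition besicovitch_saturation :: "(nat \<Rightarrow> 'a) set \<Rightarrow> (nat \<Rightarrow> 'a) set" where
  "besicovitch_saturation Y = {z. \<exists>y\<in>Y. besicovitch_dist y z = 0}"


section \<open>Abstract simplicial complexes\<close>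

definition abstract_simplicial_complex :: "'v set \<Rightarrow> 'v set set \<Rightarrow> bool" where
  "abstract_simplicial_complex V K \<longleftrightarrow>
     finite V \<and> K \<subseteq> Pow V \<and> (\<forall>T\<in>K. \<forall>S. S \<subseteq> T \<longrightarrow> S \<in> K)"

text \<open>The map \<open>f\<close> places the vertices at linearly independent points. Such a placement exists
  in every Euclidean space of dimension at least \<^term>\<open>card V\<close>, in particular in
  \<open>real ^ 'n\<close> with \<open>CARD('n) = card V\<close> if \<open>V\<close> is nonempty.\<close>

definition vertex_placement :: "'v set \<Rightarrow> ('v \<Rightarrow> 'e::euclidean_space) \<Rightarrow> bool" where
  "vertex_placement V f \<longleftrightarrow> inj_on f V \<and> independent (f ` V)"

definition geometric_realization :: "('v \<Rightarrow> 'e::euclidean_space) \<Rightarrow> 'v set set \<Rightarrow> 'e set" where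
  "geometric_realization f K = (\<Union>T\<in>K. convex hull (f ` T))"

end

(* A mixing sofic shift has a synchronizing word w; words w c with w c w in the language can be
   concatenated freely, and they exist in every large length. Positive entropy provides one such
   word P j of common length l for every vertex j, pairwise not conjugate by rotation. For a set
   T of vertices let Y T consist of the shifts of all concatenations of the words P j ^ 5 and
   P j ^ 4 q with j in T, where q has length l + 1; the union of the Y T over all T in K is the
   required Y.

   As the two lengths are coprime, points of Y T can be cut and pasted at sparse positions,
   up to changes of density 0. The upper density of the positions where a long factor of the
   periodic point (P j) (P j) ... starts is Lipschitz in the Besicovitch pseudometric, vanishes
   on Y T if j is not in T, and is positive for some j in T. Normalising these densities gives
   barycentric coordinates, hence a map Phi from the saturation of Y to the realization. The map
   Psi in the other direction pastes the periodic points of the vertices together in proportions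
   given by the barycentric coordinates. Phi o Psi preserves every simplex, so it is homotopic to
   the identity along segments. The homotopy from the identity to Psi o Phi replaces y by
   Psi (Phi y) on a set of positions of density s, at time s. *)
theory Submission
  imports Defs "HOL-Library.Discrete_Functions" "HOL-Real_Asymp.Real_Asymp"
begin

section \<open>Upper density\<close>

definition upper_density :: "nat set \<Rightarrow> ereal" where
  "upper_density A = limsup (\<lambda>n. ereal (real (card {i. i \<le> n \<and> i \<in> A}) / real (n + 1)))"

lemma besicovitch_dist_upper_density:
  "besicovitch_dist x y = upper_density {i. x i \<noteq> y i}"
  by (simp add: besicovitch_dist_def upper_density_def)

lemma finite_initial [simp]: "finite {i::nat. i \<le> n \<and> P i}"
  by (rule finite_subset[of _ "{..n}"]) auto

lemma upper_density_nonneg [simp]: "0 \<le> upper_density A"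
proof -
  have "0 = limsup (\<lambda>n::nat. 0::ereal)" by (simp add: Limsup_const)
  also have "\<dots> \<le> upper_density A"
    unfolding upper_density_def by (rule Limsup_mono) simp
  finally show ?thesis .
qed

lemma upper_density_leI:
  assumes "\<And>n. real (card {i. i \<le> n \<and> i \<in> A}) \<le> f n"
    and "(\<lambda>n. f n / real (n + 1)) \<longlonglongrightarrow> l"
  shows "upper_density A \<le> ereal l"
proof -
  have "upper_density A \<le> limsup (\<lambda>n. ereal (f n / real (n + 1)))"
    unfolding upper_density_def
    by (rule Limsup_mono) (auto intro!: always_eventually divide_right_mono assms)
  also have "\<dots> = ereal l"
    using assms(2) by (intro lim_imp_Limsup) auto
  finally show ?thesis .
qed

lemma upper_density_le_1: "upper_density A \<le> 1"
proof -
  have "upper_density A \<le> ereal 1"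
  proof (rule upper_density_leI)
    show "real (card {i. i \<le> n \<and> i \<in> A}) \<le> real (n + 1)" for n
    proof -
      have "card {i. i \<le> n \<and> i \<in> A} \<le> card {..n}" by (rule card_mono) auto
      then show ?thesis by simp
    qed
    show "(\<lambda>n. real (n + 1) / real (n + 1)) \<longlonglongrightarrow> 1"
      by (rule tendsto_eventually) (auto intro!: always_eventually)
  qed
  then show ?thesis by (simp add: one_ereal_def)
qed

text \<open>The additive slack \<open>k\<close> is divided by \<open>n + 1\<close> and disappears in
  the limit, so boundary effects of bounded size may be ignored when counting.\<close>

lemma upper_density_le_add:
  assumes "\<And>n. card {i. i \<le> n \<and> i \<in> A} \<le>
      card {i. i \<le> n \<and> i \<in> B} + card {i. i \<le> n \<and> i \<in> C} + k"
  shows "upper_density A \<le> upper_density B + upper_density C"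
proof -
  let ?d = "\<lambda>A n. ereal (real (card {i. i \<le> n \<and> i \<in> A}) / real (n + 1))"
  have "upper_density A \<le> limsup (\<lambda>n. (?d B n + ?d C n) + ereal (real k / real (n + 1)))"
    unfolding upper_density_def
  proof (rule Limsup_mono, rule always_eventually, rule allI)
    fix n
    have "real (card {i. i \<le> n \<and> i \<in> A}) \<le>
        real (card {i. i \<le> n \<and> i \<in> B}) + real (card {i. i \<le> n \<and> i \<in> C}) + real k"
      using assms[of n] by linarith
    then have "real (card {i. i \<le> n \<and> i \<in> A}) / real (n + 1) \<le>
        (real (card {i. i \<le> n \<and> i \<in> B}) + real (card {i. i \<le> n \<and> i \<in> C}) + real k) / real (n + 1)"
      by (rule divide_right_mono) simp
    then show "?d A n \<le> (?d B n + ?d C n) + ereal (real k / real (n + 1))"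
      by (simp add: add_divide_distrib)
  qed
  also have "\<dots> \<le> limsup (\<lambda>n. ?d B n + ?d C n) + limsup (\<lambda>n. ereal (real k / real (n + 1)))"
    by (rule ereal_limsup_add_mono)
  also have "limsup (\<lambda>n. ereal (real k / real (n + 1))) = ereal 0"
  proof (rule lim_imp_Limsup)
    have "(\<lambda>n. real k / real (n + 1)) \<longlonglongrightarrow> 0"
      using LIMSEQ_Suc[OF lim_const_over_n[of "real k"]] by simp
    then show "(\<lambda>n. ereal (real k / real (n + 1))) \<longlonglongrightarrow> ereal 0" by simp
  qed simp
  also have "limsup (\<lambda>n. ?d B n + ?d C n) + ereal 0 \<le> upper_density B + upper_density C"
    unfolding upper_density_def zero_ereal_def[symmetric] add_0_right by (rule ereal_limsup_add_mono)
  finally show ?thesis .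
qed

lemma upper_density_empty [simp]: "upper_density {} = 0"
  by (simp add: upper_density_def Limsup_const)

lemma upper_density_le:
  assumes "\<And>n. card {i. i \<le> n \<and> i \<in> A} \<le> card {i. i \<le> n \<and> i \<in> B} + k"
  shows "upper_density A \<le> upper_density B"
  using upper_density_le_add[of A B "{}" k] assms by simp

lemma upper_density_mono: "A \<subseteq> B \<Longrightarrow> upper_density A \<le> upper_density B"
  by (rule upper_density_le[of _ _ 0]) (auto intro!: card_mono)

lemma upper_density_Un: "upper_density (A \<union> B) \<le> upper_density A + upper_density B"
proof (rule upper_density_le_add[of _ _ _ 0])
  fix n
  have "{i. i \<le> n \<and> i \<in> A \<union> B} = {i. i \<le> n \<and> i \<in> A} \<union> {i. i \<le> n \<and> i \<in> B}"
    by auto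
  then show "card {i. i \<le> n \<and> i \<in> A \<union> B} \<le>
      card {i. i \<le> n \<and> i \<in> A} + card {i. i \<le> n \<and> i \<in> B} + 0"
    by (simp add: card_Un_le)
qed

lemma upper_density_UN:
  "finite I \<Longrightarrow> upper_density (\<Union>i\<in>I. A i) \<le> (\<Sum>i\<in>I. upper_density (A i))"
proof (induction I rule: finite_induct)
  case (insert a I)
  have "upper_density (\<Union>i\<in>insert a I. A i) \<le> upper_density (A a) + upper_density (\<Union>i\<in>I. A i)"
    using upper_density_Un by simp
  then show ?case
    using add_left_mono[OF insert.IH, of "upper_density (A a)"] insert.hyps
    by (simp add: order_trans[rotated])
qed simp

text \<open>Adding \<open>t\<close> maps the counted positions injectively into \<open>A\<close>; at
  most \<open>t\<close> of the images exceed \<open>n\<close>, and the slack absorbs these.\<close>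

lemma upper_density_preshift: "upper_density {i. i + t \<in> A} \<le> upper_density A"
proof (rule upper_density_le)
  fix n
  have "card {i. i \<le> n \<and> i \<in> {i. i + t \<in> A}} = card ((\<lambda>i. i + t) ` {i. i \<le> n \<and> i + t \<in> A})"
    by (subst card_image) auto
  also have "\<dots> \<le> card ({i. i \<le> n \<and> i \<in> A} \<union> {n<..n+t})"
    by (rule card_mono) auto
  also have "\<dots> \<le> card {i. i \<le> n \<and> i \<in> A} + t"
    by (rule order_trans[OF card_Un_le]) simp
  finally show "card {i. i \<le> n \<and> i \<in> {i. i + t \<in> A}} \<le> card {i. i \<le> n \<and> i \<in> A} + t" .
qed

lemma upper_density_postshift: "upper_density {i. t \<le> i \<and> i - t \<in> A} \<le> upper_density A"
proof (rule upper_density_le[of _ _ 0])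
  fix n
  have "card {i. i \<le> n \<and> i \<in> {i. t \<le> i \<and> i - t \<in> A}} \<le> card ((\<lambda>i. i + t) ` {i. i \<le> n \<and> i \<in> A})"
  proof (rule card_mono)
    show "{i. i \<le> n \<and> i \<in> {i. t \<le> i \<and> i - t \<in> A}} \<subseteq> (\<lambda>i. i + t) ` {i. i \<le> n \<and> i \<in> A}"
    proof
      fix i assume "i \<in> {i. i \<le> n \<and> i \<in> {i. t \<le> i \<and> i - t \<in> A}}"
      then show "i \<in> (\<lambda>i. i + t) ` {i. i \<le> n \<and> i \<in> A}"
        by (intro image_eqI[of _ _ "i - t"]) auto
    qed
  qed simp
  also have "\<dots> \<le> card {i. i \<le> n \<and> i \<in> A}" by (rule card_image_le) simp
  finally show "card {i. i \<le> n \<and> i \<in> {i. t \<le> i \<and> i - t \<in> A}} \<le> card {i. i \<le> n \<and> i \<in> A} + 0"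
    by simp
qed

text \<open>A union of \<open>m\<close> translates. Applied to a set of disagreements, it bounds the
  windows of length \<open>m\<close> that meet one, which gives Lipschitz bounds for window
  statistics.\<close>

lemma upper_density_prethicken:
  "upper_density {i. \<exists>t<m. i + t \<in> A} \<le> ereal (real m) * upper_density A"
proof -
  have "{i. \<exists>t<m. i + t \<in> A} = (\<Union>t\<in>{..<m}. {i. i + t \<in> A})" by auto
  then have "upper_density {i. \<exists>t<m. i + t \<in> A} \<le> (\<Sum>t\<in>{..<m}. upper_density {i. i + t \<in> A})"
    using upper_density_UN[of "{..<m}"] by simp
  also have "\<dots> \<le> (\<Sum>t\<in>{..<m}. upper_density A)"
    by (intro sum_mono upper_density_preshift)
  also have "\<dots> = ereal (real m) * upper_density A"
    by (induction m) (auto simp: ereal_right_distrib algebra_simps simp flip: plus_ereal.simps)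
  finally show ?thesis .
qed

text \<open>Finitely many translates cover a bounded thickening to both sides; so rewriting a
  bounded block around each sparse cut is free in the pseudometric.\<close>

lemma upper_density_thicken_0:
  assumes "upper_density A = 0"
  shows "upper_density {i. \<exists>a\<in>A. a < i + m \<and> i < a + m} = 0"
proof -
  have "{i. \<exists>a\<in>A. a < i + m \<and> i < a + m} \<subseteq>
      (\<Union>t\<in>{..<m}. {i. i + t \<in> A} \<union> {i. t \<le> i \<and> i - t \<in> A})"
  proof
    fix i assume "i \<in> {i. \<exists>a\<in>A. a < i + m \<and> i < a + m}"
    then obtain a where a: "a \<in> A" "a < i + m" "i < a + m" by auto
    show "i \<in> (\<Union>t\<in>{..<m}. {i. i + t \<in> A} \<union> {i. t \<le> i \<and> i - t \<in> A})"
    proof (cases "i \<le> a")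
      case True
      then show ?thesis using a by (intro UN_I[of "a - i"]) auto
    next
      case False
      then show ?thesis using a by (intro UN_I[of "i - a"]) auto
    qed
  qed
  then have "upper_density {i. \<exists>a\<in>A. a < i + m \<and> i < a + m} \<le>
      (\<Sum>t\<in>{..<m}. upper_density ({i. i + t \<in> A} \<union> {i. t \<le> i \<and> i - t \<in> A}))"
    by (rule order_trans[OF upper_density_mono upper_density_UN]) simp
  also have "\<dots> \<le> (\<Sum>t\<in>{..<m}. 0)"
  proof (rule sum_mono)
    fix t
    have "upper_density ({i. i + t \<in> A} \<union> {i. t \<le> i \<and> i - t \<in> A}) \<le>
        upper_density {i. i + t \<in> A} + upper_density {i. t \<le> i \<and> i - t \<in> A}"
      by (rule upper_density_Un)
    also have "\<dots> \<le> 0 + 0"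
      using upper_density_preshift[of t A] upper_density_postshift[of t A] assms
      by (intro add_mono) auto
    finally show "upper_density ({i. i + t \<in> A} \<union> {i. t \<le> i \<and> i - t \<in> A}) \<le> 0" by simp
  qed
  finally show ?thesis by (simp add: antisym)
qed

section \<open>Real-valued density and pseudometric; all values lie between 0 and 1\<close>

definition bdist :: "(nat \<Rightarrow> 'a) \<Rightarrow> (nat \<Rightarrow> 'a) \<Rightarrow> real" where
  "bdist x y = real_of_ereal (besicovitch_dist x y)"

definition udens :: "nat set \<Rightarrow> real" where
  "udens A = real_of_ereal (upper_density A)"

lemma ereal_udens: "ereal (udens A) = upper_density A"
  unfolding udens_def
  using upper_density_nonneg[of A] upper_density_le_1[of A]
  by (intro ereal_real') (auto simp: abs_eq_infinity_cases)

lemma ereal_bdist: "ereal (bdist x y) = besicovitch_dist x y"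
  unfolding bdist_def besicovitch_dist_upper_density
  using ereal_udens[unfolded udens_def] .

lemma bdist_udens: "bdist x y = udens {i. x i \<noteq> y i}"
  by (simp add: bdist_def udens_def besicovitch_dist_upper_density)

lemma udens_nonneg [simp]: "0 \<le> udens A"
  by (simp add: udens_def real_of_ereal_pos)

lemma udens_empty [simp]: "udens {} = 0"
  by (simp add: udens_def)

lemma udens_mono: "A \<subseteq> B \<Longrightarrow> udens A \<le> udens B"
  using upper_density_mono[of A B] by (simp flip: ereal_udens)

lemma udens_Un: "udens (A \<union> B) \<le> udens A + udens B"
  using upper_density_Un[of A B] by (simp flip: ereal_udens)

lemma udens_UN: "finite I \<Longrightarrow> udens (\<Union>i\<in>I. A i) \<le> (\<Sum>i\<in>I. udens (A i))"
  using upper_density_UN[of I A] by (simp flip: ereal_udens)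

lemma udens_prethicken: "udens {i. \<exists>t<m. i + t \<in> A} \<le> real m * udens A"
  using upper_density_prethicken[of m A] by (simp flip: ereal_udens)

lemma udens_thicken_0:
  "udens A = 0 \<Longrightarrow> udens {i. \<exists>a\<in>A. a < i + m \<and> i < a + m} = 0"
  using upper_density_thicken_0[of A m]
  by (simp flip: ereal_udens add: zero_ereal_def)

lemma udens_leI:
  assumes "\<And>n. real (card {i. i \<le> n \<and> i \<in> A}) \<le> f n"
    and "(\<lambda>n. f n / real (n + 1)) \<longlonglongrightarrow> l"
  shows "udens A \<le> l"
  using upper_density_leI[OF assms] by (simp flip: ereal_udens)

lemma udens_UNIV: "udens UNIV = 1"
proof -
  have "upper_density UNIV = 1"
    by (simp add: upper_density_def Limsup_const one_ereal_def del: of_nat_Suc)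
  then show ?thesis by (simp add: udens_def)
qed

lemma bdist_nonneg [simp]: "0 \<le> bdist x y"
  by (simp add: bdist_udens)

lemma bdist_refl [simp]: "bdist x x = 0"
  by (simp add: bdist_udens)

lemma bdist_commute: "bdist x y = bdist y x"
  by (simp add: bdist_udens eq_commute)

lemma bdist_triangle: "bdist x z \<le> bdist x y + bdist y z"
proof -
  have "{i. x i \<noteq> z i} \<subseteq> {i. x i \<noteq> y i} \<union> {i. y i \<noteq> z i}" by auto
  then show ?thesis
    unfolding bdist_udens by (meson order_trans udens_Un udens_mono)
qed

section \<open>An equidistributed sequence with sparse level crossings\<close>

text \<open>Runs linearly from 0 towards 1 on every block from \<open>k\<^sup>2\<close> to \<open>(k + 1)\<^sup>2\<close>. It is
  equidistributed but crosses any given level only at positions of density 0, so cutting and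
  pasting along its level sets needs only sparse cuts.\<close>

definition sweep :: "nat \<Rightarrow> real" where
  "sweep i = real (i - (floor_sqrt i)\<^sup>2) / real (2 * floor_sqrt i + 1)"

lemma sweep_nonneg: "0 \<le> sweep i"
  by (simp add: sweep_def)

lemma floor_sqrt_block:
  assumes "j < 2 * k + 1"
  shows "floor_sqrt (k\<^sup>2 + j) = k"
  using assms by (intro floor_sqrt_unique) (auto simp: power2_eq_square)

lemma sweep_block: "j < 2 * k + 1 \<Longrightarrow> sweep (k\<^sup>2 + j) = real j / real (2 * k + 1)"
  using floor_sqrt_block[of j k] by (simp add: sweep_def)

lemma sweep_less_1: "sweep i < 1"
proof -
  have "i < (Suc (floor_sqrt i))\<^sup>2" by (rule Suc_floor_sqrt_power2_gt)
  then have "i - (floor_sqrt i)\<^sup>2 < 2 * floor_sqrt i + 1"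
    by (auto simp: power2_eq_square)
  then have "real (i - (floor_sqrt i)\<^sup>2) < real (2 * floor_sqrt i + 1)"
    unfolding of_nat_less_iff .
  then show ?thesis
    unfolding sweep_def by (subst divide_less_eq_1_pos) auto
qed

text \<open>The squares cut the naturals into blocks of length \<open>2 * k + 1\<close>. Only
  \<open>k\<close> blocks lie below \<open>k\<^sup>2\<close>, so an error \<open>e\<close> per block
  adds up to \<open>k * e\<close>.\<close>

lemma card_squares_le:
  assumes c: "\<And>k. real (card {j. j < 2 * k + 1 \<and> k\<^sup>2 + j \<in> A}) \<le> real (2 * k + 1) * d + e"
  shows "real (card {i. i < k\<^sup>2 \<and> i \<in> A}) \<le> real (k\<^sup>2) * d + real k * e"
proof (induction k)
  case 0
  then show ?case by simp
next
  case (Suc k)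
  have "{i. i < (Suc k)\<^sup>2 \<and> i \<in> A} =
      {i. i < k\<^sup>2 \<and> i \<in> A} \<union> (\<lambda>j. k\<^sup>2 + j) ` {j. j < 2 * k + 1 \<and> k\<^sup>2 + j \<in> A}"
    (is "?L = ?R \<union> ?S")
  proof
    show "?L \<subseteq> ?R \<union> ?S"
    proof
      fix i assume i: "i \<in> ?L"
      show "i \<in> ?R \<union> ?S"
      proof (cases "i < k\<^sup>2")
        case False
        with i show ?thesis
          by (intro UnI2 image_eqI[of _ _ "i - k\<^sup>2"]) (auto simp: power2_eq_square)
      qed (use i in auto)
    qed
    show "?R \<union> ?S \<subseteq> ?L" by (auto simp: power2_eq_square)
  qed
  then have "card ?L \<le> card ?R + card ?S"
    by (simp add: card_Un_le)
  also have "card ?S \<le> card {j. j < 2 * k + 1 \<and> k\<^sup>2 + j \<in> A}"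
    by (rule card_image_le) simp
  finally have "real (card ?L) \<le>
      real (card ?R) + real (card {j. j < 2 * k + 1 \<and> k\<^sup>2 + j \<in> A})"
    by linarith
  also have "\<dots> \<le> real (k\<^sup>2) * d + real k * e + (real (2 * k + 1) * d + e)"
    by (intro add_mono Suc.IH c)
  also have "\<dots> = real ((Suc k)\<^sup>2) * d + real (Suc k) * e"
    by (simp add: power2_eq_square algebra_simps)
  finally show ?case .
qed

text \<open>The next square above \<open>n\<close> exceeds it by order \<open>sqrt n\<close>, and
  about \<open>sqrt n\<close> blocks contribute one error \<open>e\<close> each; both vanish after
  division by \<open>n + 1\<close>.\<close>

lemma udens_squares_le:
  assumes c: "\<And>k. real (card {j. j < 2 * k + 1 \<and> k\<^sup>2 + j \<in> A}) \<le> real (2 * k + 1) * d + e"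
    and "0 \<le> d" "0 \<le> e"
  shows "udens A \<le> d"
proof (rule udens_leI)
  let ?f = "\<lambda>n. (sqrt (real n) + 1)\<^sup>2 * d + (sqrt (real n) + 1) * e"
  fix n
  let ?k = "Suc (floor_sqrt n)"
  have k: "real ?k \<le> sqrt (real n) + 1"
    by (simp add: real_le_rsqrt flip: of_nat_power)
  have "card {i. i \<le> n \<and> i \<in> A} \<le> card {i. i < ?k\<^sup>2 \<and> i \<in> A}"
    using Suc_floor_sqrt_power2_gt[of n] by (intro card_mono) auto
  then have "real (card {i. i \<le> n \<and> i \<in> A}) \<le> real (card {i. i < ?k\<^sup>2 \<and> i \<in> A})"
    by simp
  also have "\<dots> \<le> real (?k\<^sup>2) * d + real ?k * e"
    by (rule card_squares_le[OF c])
  also have "\<dots> \<le> ?f n"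
    unfolding of_nat_power
    by (intro add_mono mult_right_mono power_mono k assms) auto
  finally show "real (card {i. i \<le> n \<and> i \<in> A}) \<le> ?f n" .
next
  show "(\<lambda>n. ((sqrt (real n) + 1)\<^sup>2 * d + (sqrt (real n) + 1) * e) / real (n + 1)) \<longlonglongrightarrow> d"
    by real_asymp
qed

text \<open>On block \<open>k\<close> the values are multiples of \<open>1 / (2 * k + 1)\<close>,
  each taken once, so a half-open interval is hit at most \<open>(2 * k + 1) * (b - a) + 1\<close>
  times.\<close>

lemma udens_sweep:
  assumes "a \<le> b"
  shows "udens {i. a \<le> sweep i \<and> sweep i < b} \<le> b - a"
proof (rule udens_squares_le[where e = 1])
  fix k :: nat
  let ?m = "real (2 * k + 1)"
  let ?J = "{j. j < 2 * k + 1 \<and> k\<^sup>2 + j \<in> {i. a \<le> sweep i \<and> sweep i < b}}"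
  have m: "?m > 0" by simp
  have J: "a * ?m \<le> real j" "real j < b * ?m" if "j \<in> ?J" for j
  proof -
    have "a \<le> real j / ?m" "real j / ?m < b"
      using that sweep_block[of j k] by auto
    then show "a * ?m \<le> real j" "real j < b * ?m"
      using m by (simp_all only: pos_le_divide_eq pos_divide_less_eq)
  qed
  have "card ?J \<le> card {\<lceil>a * ?m\<rceil>..<\<lceil>b * ?m\<rceil>}"
  proof (rule card_inj_on_le)
    show "int ` ?J \<subseteq> {\<lceil>a * ?m\<rceil>..<\<lceil>b * ?m\<rceil>}"
    proof safe
      fix j assume "j < 2 * k + 1" "a \<le> sweep (k\<^sup>2 + j)" "sweep (k\<^sup>2 + j) < b"
      then have "j \<in> ?J" by simp
      from J[OF this] show "int j \<in> {\<lceil>a * ?m\<rceil>..<\<lceil>b * ?m\<rceil>}"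
        by (auto simp: ceiling_le_iff less_ceiling_iff)
    qed
  qed auto
  then have "real (card ?J) \<le> real (nat (\<lceil>b * ?m\<rceil> - \<lceil>a * ?m\<rceil>))"
    by simp
  also have "\<dots> \<le> ?m * (b - a) + 1"
  proof -
    have "a * ?m \<le> b * ?m" using assms m by (intro mult_right_mono) auto
    moreover have "?m * (b - a) = b * ?m - a * ?m" by (simp add: algebra_simps)
    ultimately show ?thesis by linarith
  qed
  finally show "real (card ?J) \<le> ?m * (b - a) + 1" .
qed (use assms in auto)

lemma udens_sweep_crossing: "udens {i. (sweep i < a) \<noteq> (sweep (Suc i) < a)} = 0"
proof -
  have "udens {i. (sweep i < a) \<noteq> (sweep (Suc i) < a)} \<le> 0"
  proof (rule udens_squares_le[where e = 2])
    fix k :: nat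
    let ?m = "real (2 * k + 1)"
    let ?J = "{j. j < 2 * k + 1 \<and> k\<^sup>2 + j \<in> {i. (sweep i < a) \<noteq> (sweep (Suc i) < a)}}"
    have m: "?m > 0" by simp
    \<comment> \<open>\<open>2 * k\<close> is the last position of the block, after which
      \<open>sweep\<close> restarts at 0. Inside the block \<open>sweep\<close> increases, so the
      level is crossed at most once, at the \<open>j\<close> with
      \<open>j < a * ?m \<le> j + 1\<close>.\<close>
    have "?J \<subseteq> {2 * k, nat (\<lceil>a * ?m\<rceil> - 1)}"
    proof
      fix j assume j: "j \<in> ?J"
      show "j \<in> {2 * k, nat (\<lceil>a * ?m\<rceil> - 1)}"
      proof (cases "Suc j < 2 * k + 1")
        case True
        then have "(real j / ?m < a) \<noteq> (real (Suc j) / ?m < a)"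
          using j sweep_block[of j k] sweep_block[of "Suc j" k] by auto
        then have "(real j < a * ?m) \<noteq> (real (Suc j) < a * ?m)"
          using m by (simp only: pos_divide_less_eq not_False_eq_True)
        then have "real j < a * ?m \<and> a * ?m \<le> real j + 1"
          by (cases "real j < a * ?m") linarith+
        then have "\<lceil>a * ?m\<rceil> = int j + 1" by (intro ceiling_unique) auto
        then show ?thesis by simp
      qed (use j in auto)
    qed
    then have "card ?J \<le> card {2 * k, nat (\<lceil>a * ?m\<rceil> - 1)}" by (intro card_mono) auto
    also have "\<dots> \<le> 2" by (simp add: card_insert_if)
    finally show "real (card ?J) \<le> ?m * 0 + 2" by simp
  qed auto
  then show ?thesis by (simp add: antisym)
qed

section \<open>The Besicovitch topology\<close>

lemma openin_besicovitch_iff: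
  "openin besicovitch_topology U \<longleftrightarrow> (\<forall>x\<in>U. \<exists>e>0. {y. bdist x y < e} \<subseteq> U)"
proof -
  have "(\<exists>e>0. {y. besicovitch_dist x y < e} \<subseteq> U) \<longleftrightarrow> (\<exists>e>0. {y. bdist x y < e} \<subseteq> U)" for x
  proof
    assume "\<exists>e>0. {y. besicovitch_dist x y < e} \<subseteq> U"
    then obtain e where e: "e > 0" "{y. besicovitch_dist x y < e} \<subseteq> U" by blast
    \<comment> \<open>The given radius may be infinite; a positive real radius below it does as
      well.\<close>
    obtain r where r: "r > 0" "ereal r \<le> e"
      using e(1) ereal_dense2[of 0 e] by (auto simp: less_imp_le)
    have "{y. bdist x y < r} \<subseteq> {y. besicovitch_dist x y < e}"
      using r(2) by (auto simp flip: ereal_bdist intro: less_le_trans[of _ "ereal r"])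
    then show "\<exists>e>0. {y. bdist x y < e} \<subseteq> U" using r(1) e(2) by blast
  next
    assume "\<exists>e>0. {y. bdist x y < e} \<subseteq> U"
    then obtain e where "e > 0" "{y. bdist x y < e} \<subseteq> U" by blast
    then show "\<exists>e>0. {y. besicovitch_dist x y < e} \<subseteq> U"
      by (intro exI[of _ "ereal e"]) (auto simp flip: ereal_bdist)
  qed
  then show ?thesis by (simp add: openin_besicovitch_topology)
qed

lemma openin_bdist_ball: "openin besicovitch_topology {y. bdist x y < e}"
  unfolding openin_besicovitch_iff
proof
  fix y assume "y \<in> {y. bdist x y < e}"
  then show "\<exists>d>0. {z. bdist y z < d} \<subseteq> {y. bdist x y < e}"
    by (intro exI[of _ "e - bdist x y"]) (auto intro: order_le_less_trans[OF bdist_triangle[of x _ y]])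
qed

lemma continuous_map_into_besicovitch:
  fixes F :: "'b \<Rightarrow> nat \<Rightarrow> 'a"
  assumes "\<And>x e. x \<in> topspace T \<Longrightarrow> e > 0 \<Longrightarrow>
      \<exists>U. openin T U \<and> x \<in> U \<and> (\<forall>y\<in>U. bdist (F x) (F y) < e)"
  shows "continuous_map T besicovitch_topology F"
  unfolding continuous_map_def
proof (intro conjI allI impI)
  fix W :: "(nat \<Rightarrow> 'a) set" assume W: "openin besicovitch_topology W"
  show "openin T {x \<in> topspace T. F x \<in> W}"
  proof (subst openin_subopen, intro ballI)
    fix x assume "x \<in> {x \<in> topspace T. F x \<in> W}"
    then have x: "x \<in> topspace T" "F x \<in> W" by auto
    obtain e where e: "e > 0" "{y. bdist (F x) y < e} \<subseteq> W"
      using W x(2) unfolding openin_besicovitch_iff by blast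
    obtain U where U: "openin T U" "x \<in> U" "\<forall>y\<in>U. bdist (F x) (F y) < e"
      using assms[OF x(1) e(1)] by blast
    have "U \<subseteq> {x \<in> topspace T. F x \<in> W}"
      using U openin_subset[OF U(1)] e(2) by auto
    then show "\<exists>U. openin T U \<and> x \<in> U \<and> U \<subseteq> {x \<in> topspace T. F x \<in> W}"
      using U by blast
  qed
qed simp

lemma continuous_map_besicovitch_real:
  assumes "\<And>y z. \<bar>g y - g z\<bar> \<le> M * bdist y z"
  shows "continuous_map (subtopology besicovitch_topology S) euclideanreal g"
proof (rule continuous_map_from_subtopology, unfold continuous_map_def, intro conjI allI impI)
  fix W :: "real set" assume W: "openin euclideanreal W"
  have "\<exists>e>0. {z. bdist y z < e} \<subseteq> {z. g z \<in> W}" if y: "g y \<in> W" for y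
  proof -
    obtain d where d: "d > 0" "\<And>r. dist r (g y) < d \<Longrightarrow> r \<in> W"
      using W y by (metis open_dist open_openin)
    \<comment> \<open>The radius uses \<open>\<bar>M\<bar> + 1\<close>, which is positive for every
      \<open>M\<close>.\<close>
    show ?thesis
    proof (intro exI[of _ "d / (\<bar>M\<bar> + 1)"] conjI subsetI)
      fix z assume "z \<in> {z. bdist y z < d / (\<bar>M\<bar> + 1)}"
      then have "bdist y z * (\<bar>M\<bar> + 1) < d" by (simp add: pos_less_divide_eq)
      moreover have "M * bdist y z \<le> bdist y z * (\<bar>M\<bar> + 1)"
        by (simp add: mult.commute[of M] mult_left_mono)
      ultimately have "\<bar>g y - g z\<bar> < d" using assms[of y z] by linarith
      then show "z \<in> {z. g z \<in> W}" using d(2) by (simp add: dist_real_def abs_minus_commute)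
    qed (use d in auto)
  qed
  then show "openin besicovitch_topology {x \<in> topspace besicovitch_topology. g x \<in> W}"
    by (simp add: openin_besicovitch_iff)
qed simp

lemma besicovitch_saturation_iff:
  "z \<in> besicovitch_saturation Y \<longleftrightarrow> (\<exists>y\<in>Y. bdist y z = 0)"
  by (auto simp: besicovitch_saturation_def zero_ereal_def simp flip: ereal_bdist)

text \<open>Equidistribution bounds the change of a level set of \<open>sweep\<close> by the change
  of the level; this makes pasting along a level continuous in that level.\<close>

lemma udens_sweep_less:
  "udens {i. (sweep i < a) \<noteq> (sweep i < b)} \<le> \<bar>a - b\<bar>"
proof -
  have *: "udens {i. (sweep i < a) \<noteq> (sweep i < b)} \<le> b - a" if "a \<le> b" for a b
  proof -
    have "{i. (sweep i < a) \<noteq> (sweep i < b)} \<subseteq> {i. a \<le> sweep i \<and> sweep i < b}"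
      using that by auto
    from order_trans[OF udens_mono[OF this] udens_sweep[OF that]] show ?thesis .
  qed
  show ?thesis
  proof (cases "a \<le> b")
    case False
    then have "udens {i. (sweep i < b) \<noteq> (sweep i < a)} \<le> a - b" by (intro *) simp
    then show ?thesis using False by (simp add: eq_commute)
  qed (use *[of a b] in auto)
qed

section \<open>Barycentric coordinates and the homotopy equivalence for families closed under
  pasting\<close>

lemma barycentric_coordinates:
  fixes F :: "nat \<Rightarrow> 'e::euclidean_space"
  assumes "inj_on F {..<N}" "independent (F ` {..<N})"
  obtains h where "\<And>j. linear (h j :: 'e \<Rightarrow> real)"
    "\<And>T t. T \<subseteq> {..<N} \<Longrightarrow> t \<in> convex hull (F ` T) \<Longrightarrow>
        (\<forall>j<N. h j t \<ge> 0 \<and> (j \<notin> T \<longrightarrow> h j t = 0)) \<and> (\<Sum>j<N. h j t) = 1"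
proof -
  have "\<exists>h. linear h \<and> (\<forall>x\<in>F ` {..<N}. h x = (if x = F j then 1 else 0 :: real))" for j
    by (rule linear_independent_extend[OF assms(2)])
  then obtain h where lin: "\<And>j. linear (h j)"
    and h: "\<And>j x. x \<in> F ` {..<N} \<Longrightarrow> h j x = (if x = F j then 1 else 0 :: real)"
    by metis
  have hF: "h j (F k) = (if k = j then 1 else 0)" if "j < N" "k < N" for j k
    using h[of "F k" j] inj_onD[OF assms(1), of j k] that by auto
  have "(\<forall>j<N. h j t \<ge> 0 \<and> (j \<notin> T \<longrightarrow> h j t = 0)) \<and> (\<Sum>j<N. h j t) = 1"
    if T: "T \<subseteq> {..<N}" and t: "t \<in> convex hull (F ` T)" for T t
  proof -
    \<comment> \<open>All claimed conditions survive convex combinations because each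
      \<open>h j\<close> is linear, so it is enough to check them at the vertices \<open>F k\<close>
      with \<open>k\<close> in \<open>T\<close>.\<close>
    let ?C = "{t. (\<forall>j<N. h j t \<ge> 0 \<and> (j \<notin> T \<longrightarrow> h j t = 0)) \<and> (\<Sum>j<N. h j t) = 1}"
    have "convex hull (F ` T) \<subseteq> ?C"
    proof (rule hull_minimal)
      show "F ` T \<subseteq> ?C"
      proof safe
        fix k assume k: "k \<in> T"
        then have kN: "k < N" using T by auto
        show "(\<Sum>j<N. h j (F k)) = 1"
          using kN by (subst sum.cong[OF refl hF]) auto
        show "h j (F k) \<ge> 0" if "j < N" for j using hF that kN by auto
        show "h j (F k) = 0" if "j < N" "j \<notin> T" for j using hF that kN k by auto
      qed
      show "convex ?C"
        unfolding convex_def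
      proof (intro ballI allI impI)
        fix x y and u v :: real
        assume x: "x \<in> ?C" and y: "y \<in> ?C" and uv: "0 \<le> u" "0 \<le> v" "u + v = 1"
        have comb: "h j (u *\<^sub>R x + v *\<^sub>R y) = u * h j x + v * h j y" for j
          by (simp add: linear_add[OF lin] linear_scale[OF lin])
        have "(\<Sum>j<N. h j (u *\<^sub>R x + v *\<^sub>R y)) = u * (\<Sum>j<N. h j x) + v * (\<Sum>j<N. h j y)"
          by (simp only: comb sum.distrib sum_distrib_left)
        then show "u *\<^sub>R x + v *\<^sub>R y \<in> ?C"
          using x y uv by (simp add: comb)
      qed
    qed
    then show ?thesis using t by auto
  qed
  with lin show ?thesis using that by blast
qed

text \<open>Isolates what the symbolic dynamics must supply: sparse pasting inside each
  \<open>Y T\<close>, vertex points \<open>q j\<close> common to all \<open>T\<close>, and Lipschitz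
  functions \<open>g j\<close> that tell the vertices of \<open>T\<close> from the others.\<close>

theorem homotopy_equivalent_realization:
  fixes F :: "nat \<Rightarrow> 'e::euclidean_space" and Y :: "nat set \<Rightarrow> (nat \<Rightarrow> 'a) set"
  assumes fam: "\<T> \<subseteq> Pow {..<N}"
    and F: "inj_on F {..<N}" "independent (F ` {..<N})"
    and q: "\<And>T j. T \<in> \<T> \<Longrightarrow> j \<in> T \<Longrightarrow> q j \<in> Y T"
    and glue: "\<And>T P \<sigma>. T \<in> \<T> \<Longrightarrow> (\<And>k::nat. P k \<in> Y T) \<Longrightarrow>
        udens {i. \<sigma> i \<noteq> \<sigma> (Suc i)} = 0 \<Longrightarrow> \<exists>r\<in>Y T. bdist r (\<lambda>i. P (\<sigma> i) i) = 0"
    and g_lip: "\<And>j y z. \<bar>g j y - g j z\<bar> \<le> M * bdist y z"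
    and g_nonneg: "\<And>j y. 0 \<le> g j y"
    and g_0: "\<And>T j y. T \<in> \<T> \<Longrightarrow> j < N \<Longrightarrow> j \<notin> T \<Longrightarrow> y \<in> Y T \<Longrightarrow> g j y = 0"
    and g_pos: "\<And>T y. T \<in> \<T> \<Longrightarrow> y \<in> Y T \<Longrightarrow> \<exists>j\<in>T. 0 < g j y"
  shows "subtopology besicovitch_topology (besicovitch_saturation (\<Union>T\<in>\<T>. Y T))
    homotopy_equivalent_space top_of_set (\<Union>T\<in>\<T>. convex hull (F ` T))"
proof -
  define S where "S = besicovitch_saturation (\<Union>T\<in>\<T>. Y T)"
  define R where "R = (\<Union>T\<in>\<T>. convex hull (F ` T))"
  \<comment> \<open>Membership in the saturation is recorded together with a simplex
    \<open>T\<close>, so that both maps and both homotopies can be seen to respect each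
    simplex.\<close>
  define near where "near T z \<longleftrightarrow> T \<in> \<T> \<and> (\<exists>y\<in>Y T. bdist y z = 0)" for T z
  have S_iff: "z \<in> S \<longleftrightarrow> (\<exists>T. near T z)" for z
    unfolding S_def near_def besicovitch_saturation_iff by blast
  have finT: "finite T" if "T \<in> \<T>" for T
    using that fam finite_subset by (metis PowD finite_lessThan subsetD)
  have g_near: "g j z = g j y" if "bdist y z = 0" for j y z
    using g_lip[of j y z] that by simp

  \<comment> \<open>By \<open>near_g\<close> below, \<open>tot\<close> is positive on
    \<open>S\<close>, the only place where the quotient by it matters.\<close>
  define tot where "tot z = (\<Sum>j<N. g j z)" for z
  define \<Phi> where "\<Phi> z = (\<Sum>j<N. (g j z / tot z) *\<^sub>R F j)" for z
  have near_g: "(\<forall>j<N. j \<notin> T \<longrightarrow> g j z = 0) \<and> 0 < tot z" if z: "near T z" for T z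
  proof -
    obtain y where y: "T \<in> \<T>" "y \<in> Y T" "bdist y z = 0" using z unfolding near_def by blast
    obtain j where j: "j \<in> T" "0 < g j y" using g_pos[OF y(1,2)] by blast
    have "j < N" using j(1) y(1) fam by blast
    then have "0 < tot z"
      unfolding tot_def using j(2) g_near[OF y(3)] g_nonneg
      by (intro sum_pos2[of _ j]) auto
    then show ?thesis using g_0[OF y(1) _ _ y(2)] g_near[OF y(3)] by simp
  qed
  have \<Phi>_near: "\<Phi> z \<in> convex hull (F ` T)" if "near T z" for T z
  proof -
    have T: "T \<subseteq> {..<N}" "finite T" using that fam finT unfolding near_def by blast+
    note ng = near_g[OF that]
    \<comment> \<open>Coordinates outside \<open>T\<close> vanish, so \<open>\<Phi> z\<close> is a
      convex combination of the vertices of \<open>T\<close> alone.\<close>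
    have restrict: "(\<Sum>j<N. g j z) = (\<Sum>j\<in>T. g j z)"
      using T ng by (intro sum.mono_neutral_right) auto
    have "\<Phi> z = (\<Sum>j\<in>T. (g j z / tot z) *\<^sub>R F j)"
      unfolding \<Phi>_def using T ng by (intro sum.mono_neutral_right) auto
    also have "\<dots> \<in> convex hull (F ` T)"
    proof (rule convex_sum)
      show "(\<Sum>j\<in>T. g j z / tot z) = 1"
        using ng restrict by (simp add: tot_def flip: sum_divide_distrib)
    qed (use T ng g_nonneg in \<open>auto intro: hull_inc\<close>)
    finally show ?thesis .
  qed
  have g_cont: "continuous_map (subtopology besicovitch_topology S) euclideanreal (g j)" for j
    using g_lip by (rule continuous_map_besicovitch_real)
  have \<Phi>_cont: "continuous_map (subtopology besicovitch_topology S) (top_of_set R) \<Phi>"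
    unfolding continuous_map_in_subtopology
  proof
    have lim: "(g j \<longlongrightarrow> g j z) (atin (subtopology besicovitch_topology S) z)" if "z \<in> S" for j z
      using g_cont[of j] that unfolding continuous_map_atin by simp
    have tot_lim: "(tot \<longlongrightarrow> tot z) (atin (subtopology besicovitch_topology S) z)" if "z \<in> S" for z
      unfolding tot_def[abs_def] by (intro tendsto_sum lim that)
    have tot_pos: "tot z \<noteq> 0" if "z \<in> S" for z
      using that near_g unfolding S_iff by force
    show "continuous_map (subtopology besicovitch_topology S) euclidean \<Phi>"
      unfolding continuous_map_atin \<Phi>_def[abs_def]
      by (auto intro!: tendsto_sum tendsto_scaleR tendsto_divide lim tot_lim dest: tot_pos)
    show "\<Phi> \<in> topspace (subtopology besicovitch_topology S) \<rightarrow> R"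
    proof
      fix z assume "z \<in> topspace (subtopology besicovitch_topology S)"
      then obtain T where "near T z" using S_iff by auto
      then show "\<Phi> z \<in> R" using \<Phi>_near unfolding R_def near_def by blast
    qed
  qed

  obtain h where lin: "\<And>j. linear (h j :: 'e \<Rightarrow> real)"
    and h: "\<And>T t. T \<subseteq> {..<N} \<Longrightarrow> t \<in> convex hull (F ` T) \<Longrightarrow>
        (\<forall>j<N. h j t \<ge> 0 \<and> (j \<notin> T \<longrightarrow> h j t = 0)) \<and> (\<Sum>j<N. h j t) = 1"
    using barycentric_coordinates[OF F] by blast
  \<comment> \<open>For \<open>t\<close> in \<open>R\<close> the partial sums cut [0, 1) into
    intervals of length \<open>h k t\<close>, and \<open>\<Psi> t\<close> takes its letter at
    \<open>i\<close> from the \<open>q j\<close> whose interval contains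
    \<open>sweep i\<close>.\<close>
  define cum where "cum t j = (\<Sum>k<j. h k t)" for t j
  \<comment> \<open>The disjunct \<open>N \<le> Suc j\<close> keeps the \<open>LEAST\<close> in \<open>sel\<close> well-defined for every \<open>t\<close>.\<close>
  define below where "below t i j \<longleftrightarrow> N \<le> Suc j \<or> sweep i < cum t (Suc j)" for t i j
  define sel where "sel t i = (LEAST j. below t i j)" for t i
  define \<Psi> where "\<Psi> t i = q (sel t i) i" for t i
  \<comment> \<open>\<open>sel\<close> depends on position and parameter only through comparisons of
    \<open>sweep\<close> with the levels. The rarity of its changes along \<open>i\<close> and
    continuity in \<open>t\<close> both follow from this.\<close>
  have sel_eq: "sel t i = sel t' i'"
    if "\<And>j. j < N \<Longrightarrow> sweep i < cum t (Suc j) \<longleftrightarrow> sweep i' < cum t' (Suc j)" for t i t' i'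
  proof -
    have "below t i j = below t' i' j" for j
      unfolding below_def using that[of j] by (cases "j < N") auto
    then have "below t i = below t' i'" by blast
    then show ?thesis unfolding sel_def by simp
  qed
  have sel_in: "sel t i \<in> T" if T: "T \<in> \<T>" and t: "t \<in> convex hull (F ` T)" for t i T
  proof -
    have sub: "T \<subseteq> {..<N}" using T fam by blast
    note ht = h[OF sub t]
    have "N \<noteq> 0" using ht by (metis lessThan_0 sum.empty zero_neq_one)
    define j where "j = sel t i"
    have bj: "below t i j" unfolding j_def sel_def
      by (rule LeastI[of _ N]) (simp add: below_def)
    have jN: "j < N"
    proof -
      have "j \<le> N - 1" unfolding j_def sel_def by (rule Least_le) (auto simp: below_def)
      with \<open>N \<noteq> 0\<close> show ?thesis by simp
    qed
    \<comment> \<open>At the last index the condition in \<open>below\<close> is vacuous, but there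
      the coordinates have summed to 1, which exceeds every value of \<open>sweep\<close>.\<close>
    have up: "sweep i < cum t (Suc j)"
    proof (cases "N \<le> Suc j")
      case True
      then have "Suc j = N" using jN by simp
      then have "cum t (Suc j) = 1" using ht unfolding cum_def by simp
      then show ?thesis using sweep_less_1 by simp
    qed (use bj in \<open>simp add: below_def\<close>)
    have low: "cum t j \<le> sweep i"
    proof (cases j)
      case 0
      then show ?thesis by (simp add: cum_def sweep_nonneg)
    next
      case (Suc k)
      have "\<not> below t i k"
        using not_less_Least[of k "below t i"] Suc unfolding j_def sel_def by simp
      then show ?thesis using Suc by (simp add: below_def)
    qed
    \<comment> \<open>The selected interval contains \<open>sweep i\<close>, so its length is
      positive, whereas coordinates outside \<open>T\<close> are 0.\<close>
    have "0 < h j t" using up low by (simp add: cum_def)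
    then show ?thesis using ht jN unfolding j_def by force
  qed
  have sel_changes: "udens {i. sel t i \<noteq> sel t (Suc i)} = 0" for t
  proof -
    have "{i. sel t i \<noteq> sel t (Suc i)} \<subseteq>
        (\<Union>j\<in>{..<N}. {i. (sweep i < cum t (Suc j)) \<noteq> (sweep (Suc i) < cum t (Suc j))})"
    proof (rule subsetI, rule ccontr)
      fix i assume i: "i \<in> {i. sel t i \<noteq> sel t (Suc i)}"
        "i \<notin> (\<Union>j\<in>{..<N}. {i. (sweep i < cum t (Suc j)) \<noteq> (sweep (Suc i) < cum t (Suc j))})"
      then have "sel t i = sel t (Suc i)" by (intro sel_eq) auto
      then show False using i(1) by simp
    qed
    from udens_mono[OF this] have "udens {i. sel t i \<noteq> sel t (Suc i)} \<le>
        (\<Sum>j\<in>{..<N}. udens {i. (sweep i < cum t (Suc j)) \<noteq> (sweep (Suc i) < cum t (Suc j))})"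
      by (rule order_trans[OF _ udens_UN]) simp
    then have "udens {i. sel t i \<noteq> sel t (Suc i)} \<le> 0" by (simp only: udens_sweep_crossing sum.neutral_const)
    then show ?thesis by (simp add: antisym)
  qed
  have \<Psi>_near: "near T (\<Psi> t)" if T: "T \<in> \<T>" and t: "t \<in> convex hull (F ` T)" for t T
  proof -
    \<comment> \<open>\<open>glue\<close> wants a point of \<open>Y T\<close> at every index.
      \<open>sel t 0\<close> is merely some element of \<open>T\<close>, standing in at indices
      outside \<open>T\<close>, which are never selected.\<close>
    define P where "P k = q (if k \<in> T then k else sel t 0)" for k
    have P: "P k \<in> Y T" for k
      unfolding P_def using q[OF T] sel_in[OF T t] by auto
    obtain r where r: "r \<in> Y T" "bdist r (\<lambda>i. P (sel t i) i) = 0"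
      using glue[of T P "sel t", OF T P sel_changes] by blast
    have "(\<lambda>i. P (sel t i) i) = \<Psi> t"
      unfolding P_def \<Psi>_def using sel_in[OF T t] by auto
    then show ?thesis using r T unfolding near_def by auto
  qed
  have cum_cont: "continuous_on A (\<lambda>t. cum t j)" for A j
    unfolding cum_def
    by (intro continuous_on_sum linear_continuous_on linear_conv_bounded_linear[THEN iffD1] lin)
  \<comment> \<open>Two parameters can select differently only where \<open>sweep i\<close>
    separates corresponding levels, so the movement of the levels bounds the distance.\<close>
  have \<Psi>_dist: "bdist (\<Psi> t) (\<Psi> t') \<le> (\<Sum>j<N. \<bar>cum t (Suc j) - cum t' (Suc j)\<bar>)" for t t'
  proof -
    have "{i. \<Psi> t i \<noteq> \<Psi> t' i} \<subseteq>
        (\<Union>j\<in>{..<N}. {i. (sweep i < cum t (Suc j)) \<noteq> (sweep i < cum t' (Suc j))})"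
    proof (rule subsetI, rule ccontr)
      fix i assume i: "i \<in> {i. \<Psi> t i \<noteq> \<Psi> t' i}"
        "i \<notin> (\<Union>j\<in>{..<N}. {i. (sweep i < cum t (Suc j)) \<noteq> (sweep i < cum t' (Suc j))})"
      then have "sel t i = sel t' i" by (intro sel_eq) auto
      then show False using i(1) by (simp add: \<Psi>_def)
    qed
    from udens_mono[OF this] have "bdist (\<Psi> t) (\<Psi> t') \<le>
        (\<Sum>j\<in>{..<N}. udens {i. (sweep i < cum t (Suc j)) \<noteq> (sweep i < cum t' (Suc j))})"
      unfolding bdist_udens by (rule order_trans[OF _ udens_UN]) simp
    also have "\<dots> \<le> (\<Sum>j<N. \<bar>cum t (Suc j) - cum t' (Suc j)\<bar>)"
      by (intro sum_mono udens_sweep_less)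
    finally show ?thesis .
  qed
  have \<Psi>_cont: "continuous_map (top_of_set R) (subtopology besicovitch_topology S) \<Psi>"
    unfolding continuous_map_in_subtopology
  proof
    show "continuous_map (top_of_set R) besicovitch_topology \<Psi>"
    proof (rule continuous_map_into_besicovitch)
      fix t and e :: real assume t: "t \<in> topspace (top_of_set R)" and e: "0 < e"
      let ?D = "\<lambda>t'. \<Sum>j<N. \<bar>cum t (Suc j) - cum t' (Suc j)\<bar>"
      have "continuous_on R ?D" by (intro continuous_intros cum_cont)
      then have "openin (top_of_set R) (R \<inter> ?D -` {..<e})"
        by (rule continuous_openin_preimage_gen) simp
      moreover have "t \<in> R \<inter> ?D -` {..<e}" using t e by simp
      moreover have "\<forall>t'\<in>R \<inter> ?D -` {..<e}. bdist (\<Psi> t) (\<Psi> t') < e"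
        using \<Psi>_dist[of t] by (auto intro: order_le_less_trans)
      ultimately show "\<exists>U. openin (top_of_set R) U \<and> t \<in> U \<and> (\<forall>y\<in>U. bdist (\<Psi> t) (\<Psi> y) < e)"
        by blast
    qed
    show "\<Psi> \<in> topspace (top_of_set R) \<rightarrow> S"
    proof
      fix t assume "t \<in> topspace (top_of_set R)"
      then obtain T where "T \<in> \<T>" "t \<in> convex hull (F ` T)" unfolding R_def by auto
      then show "\<Psi> t \<in> S" using \<Psi>_near S_iff by blast
    qed
  qed

  \<comment> \<open>At time \<open>s\<close> the positions with \<open>sweep\<close> below
    \<open>s\<close> have been switched: none at \<open>s = 0\<close> since \<open>sweep\<close> is
    nonnegative, all at \<open>s = 1\<close> since it stays below 1.\<close>
  define H where "H = (\<lambda>(s::real, y) i. if sweep i < s then \<Psi> (\<Phi> y) i else y i)"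
  have H_near: "near T (H (s, y))" if y: "near T y" for T s y
  proof -
    have T: "T \<in> \<T>" using y near_def by blast
    \<comment> \<open>\<open>glue\<close> applies to points of \<open>Y T\<close> itself, so both
      sequences are first replaced by representatives at distance 0; this alters the pasted sequence
      only on a set of density 0.\<close>
    have "near T (\<Psi> (\<Phi> y))" by (rule \<Psi>_near[OF T \<Phi>_near[OF y]])
    then obtain z0 where z0: "z0 \<in> Y T" "bdist z0 (\<Psi> (\<Phi> y)) = 0" unfolding near_def by blast
    obtain y0 where y0: "y0 \<in> Y T" "bdist y0 y = 0" using y unfolding near_def by blast
    define P where "P k = (if k = 0 then z0 else y0)" for k :: nat
    define \<sigma> where "\<sigma> i = (if sweep i < s then 0 else 1 :: nat)" for i
    have "{i. \<sigma> i \<noteq> \<sigma> (Suc i)} = {i. (sweep i < s) \<noteq> (sweep (Suc i) < s)}"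
      unfolding \<sigma>_def by auto
    then have "udens {i. \<sigma> i \<noteq> \<sigma> (Suc i)} = 0" by (simp only: udens_sweep_crossing)
    moreover have "P k \<in> Y T" for k using z0(1) y0(1) by (simp add: P_def)
    ultimately obtain r where r: "r \<in> Y T" "bdist r (\<lambda>i. P (\<sigma> i) i) = 0"
      using glue[of T P \<sigma>, OF T] by blast
    have "{i. P (\<sigma> i) i \<noteq> H (s, y) i} \<subseteq> {i. z0 i \<noteq> \<Psi> (\<Phi> y) i} \<union> {i. y0 i \<noteq> y i}"
      by (auto simp: P_def \<sigma>_def H_def)
    then have "bdist (\<lambda>i. P (\<sigma> i) i) (H (s, y)) \<le> bdist z0 (\<Psi> (\<Phi> y)) + bdist y0 y"
      unfolding bdist_udens by (rule order_trans[OF udens_mono udens_Un])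
    then have "bdist r (H (s, y)) \<le> 0"
      using bdist_triangle[of r "H (s, y)" "\<lambda>i. P (\<sigma> i) i"] r(2) z0(2) y0(2) by simp
    then show ?thesis using r(1) T unfolding near_def
      by (auto intro!: bexI[of _ r] antisym)
  qed
  have H_dist: "bdist (H (s, y)) (H (s', y')) \<le>
      \<bar>s - s'\<bar> + bdist (\<Psi> (\<Phi> y)) (\<Psi> (\<Phi> y')) + bdist y y'" for s s' y y'
  proof -
    have "{i. H (s, y) i \<noteq> H (s', y') i} \<subseteq> {i. (sweep i < s) \<noteq> (sweep i < s')} \<union>
        {i. \<Psi> (\<Phi> y) i \<noteq> \<Psi> (\<Phi> y') i} \<union> {i. y i \<noteq> y' i}"
      by (auto simp: H_def)
    from udens_mono[OF this] show ?thesis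
      unfolding bdist_udens
      using udens_Un[of "{i. (sweep i < s) \<noteq> (sweep i < s')} \<union> {i. \<Psi> (\<Phi> y) i \<noteq> \<Psi> (\<Phi> y') i}"
          "{i. y i \<noteq> y' i}"]
        udens_Un[of "{i. (sweep i < s) \<noteq> (sweep i < s')}" "{i. \<Psi> (\<Phi> y) i \<noteq> \<Psi> (\<Phi> y') i}"]
        udens_sweep_less[of s s']
      by linarith
  qed
  let ?S = "subtopology besicovitch_topology S"
  have \<Psi>\<Phi>_cont: "continuous_map ?S besicovitch_topology (\<Psi> \<circ> \<Phi>)"
    using continuous_map_compose[OF \<Phi>_cont \<Psi>_cont] by (simp add: continuous_map_in_subtopology)
  have "continuous_map (prod_topology (top_of_set {0..1::real}) ?S) ?S H"
    unfolding continuous_map_in_subtopology[of _ besicovitch_topology]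
  proof
    show "continuous_map (prod_topology (top_of_set {0..1::real}) ?S) besicovitch_topology H"
    proof (rule continuous_map_into_besicovitch)
      fix x :: "real \<times> (nat \<Rightarrow> 'a)" and e :: real
      assume x: "x \<in> topspace (prod_topology (top_of_set {0..1}) ?S)" and e: "0 < e"
      obtain s y where sy: "x = (s, y)" "s \<in> {0..1}" "y \<in> S" using x by auto
      define A where "A = {0..1} \<inter> ball s (e / 3)"
      define B where "B = {y' \<in> topspace ?S. (\<Psi> \<circ> \<Phi>) y' \<in> {z. bdist (\<Psi> (\<Phi> y)) z < e / 3}}"
      define C where "C = S \<inter> {z. bdist y z < e / 3}"
      have "openin (top_of_set {0..1}) A" unfolding A_def by (simp add: openin_open_Int)
      moreover have "openin ?S B"
        unfolding B_def by (rule openin_continuous_map_preimage[OF \<Psi>\<Phi>_cont openin_bdist_ball])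
      moreover have "openin ?S C"
        unfolding C_def by (rule openin_subtopology_Int2[OF openin_bdist_ball])
      ultimately have "openin (prod_topology (top_of_set {0..1}) ?S) (A \<times> (B \<inter> C))"
        by (simp add: openin_prod_Times_iff openin_Int)
      moreover have "x \<in> A \<times> (B \<inter> C)" using sy e by (auto simp: A_def B_def C_def)
      moreover have "bdist (H x) (H x') < e" if x'_in: "x' \<in> A \<times> (B \<inter> C)" for x'
      proof -
        obtain s' y' where x': "x' = (s', y')" "s' \<in> A" "y' \<in> B" "y' \<in> C" using x'_in by auto
        have "\<bar>s - s'\<bar> < e / 3" using x'(2) by (simp add: A_def dist_real_def)
        moreover have "bdist (\<Psi> (\<Phi> y)) (\<Psi> (\<Phi> y')) < e / 3" using x'(3) by (simp add: B_def)
        moreover have "bdist y y' < e / 3" using x'(4) by (simp add: C_def)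
        ultimately show ?thesis using H_dist[of s y s' y'] unfolding sy(1) x'(1) by linarith
      qed
      ultimately show "\<exists>U. openin (prod_topology (top_of_set {0..1}) ?S) U \<and> x \<in> U \<and>
          (\<forall>y\<in>U. bdist (H x) (H y) < e)"
        by blast
    qed
    show "H \<in> topspace (prod_topology (top_of_set {0..1::real}) ?S) \<rightarrow> S"
      by (auto simp: S_iff) (blast intro: H_near)
  qed
  moreover have "H (0, y) = y" for y
    by (simp add: H_def fun_eq_iff leD[OF sweep_nonneg])
  moreover have "H (1, y) = \<Psi> (\<Phi> y)" for y
    by (simp add: H_def fun_eq_iff sweep_less_1)
  ultimately have "homotopic_with (\<lambda>x. True) ?S ?S id (\<Psi> \<circ> \<Phi>)"
    unfolding homotopic_with_def by auto
  then have htpy1: "homotopic_with (\<lambda>x. True) ?S ?S (\<Psi> \<circ> \<Phi>) id"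
    by (rule homotopic_with_symD)
  have "homotopic_with_canon (\<lambda>x. True) R R (\<Phi> \<circ> \<Psi>) id"
  proof (rule homotopic_with_linear)
    show "continuous_on R (\<Phi> \<circ> \<Psi>)"
      using continuous_map_compose[OF \<Psi>_cont \<Phi>_cont]
      by (simp add: continuous_map_in_subtopology)
    show "closed_segment ((\<Phi> \<circ> \<Psi>) t) (id t) \<subseteq> R" if t: "t \<in> R" for t
    proof -
      obtain T where T: "T \<in> \<T>" "t \<in> convex hull (F ` T)" using t unfolding R_def by blast
      then have "\<Phi> (\<Psi> t) \<in> convex hull (F ` T)" by (intro \<Phi>_near \<Psi>_near)
      then have "closed_segment (\<Phi> (\<Psi> t)) t \<subseteq> convex hull (F ` T)"
        using T(2) by (intro closed_segment_subset) auto
      then show ?thesis using T(1) unfolding R_def by auto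
    qed
  qed simp
  then show ?thesis
    unfolding S_def[symmetric] R_def[symmetric] homotopy_equivalent_space_def
    using \<Phi>_cont \<Psi>_cont htpy1 by blast
qed

section \<open>Sofic shifts\<close>

text \<open>Each condition on a walk involves two neighbouring coordinates, hence is closed, and
  walks lie in the compact product of copies of the finite set \<open>E\<close>.\<close>

lemma compactin_walks:
  assumes "finite E"
  shows "compactin (product_topology (\<lambda>_::nat. discrete_topology UNIV) UNIV)
    {p. \<forall>i. p i \<in> E \<and> (p i, p (Suc i)) \<in> r}" (is "compactin ?T ?W")
proof (rule closed_compactin)
  show "compactin ?T (PiE UNIV (\<lambda>_. E))"
    using assms by (simp add: compactin_PiE finite_imp_compactin_eq)
  show "?W \<subseteq> PiE UNIV (\<lambda>_. E)" by auto
  have "closedin ?T {p \<in> topspace ?T. (p i, p (Suc i)) \<in> {(a, b). a \<in> E \<and> (a, b) \<in> r}}" for i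
  proof (rule closedin_continuous_map_preimage)
    show "continuous_map ?T (prod_topology (discrete_topology UNIV) (discrete_topology UNIV))
        (\<lambda>p. (p i, p (Suc i)))"
      by (intro continuous_map_pairedI continuous_map_product_projection) auto
  qed (simp add: prod_topology_discrete_topology[symmetric])
  then have "closedin ?T (\<Inter>i. {p \<in> topspace ?T. (p i, p (Suc i)) \<in> {(a, b). a \<in> E \<and> (a, b) \<in> r}})"
    by (intro closedin_Inter) auto
  moreover have "(\<Inter>i. {p \<in> topspace ?T. (p i, p (Suc i)) \<in> {(a, b). a \<in> E \<and> (a, b) \<in> r}}) = ?W"
    by auto
  ultimately show "closedin ?T ?W" by simp
qed

text \<open>Reading labels is continuous, so the label sequences form the image of a compact set,
  which is closed because the Cantor topology is Hausdorff.\<close>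

lemma subshift_labels:
  assumes "finite E"
  shows "subshift {x. \<exists>p. \<forall>i. p i \<in> E \<and> (p i, p (Suc i)) \<in> r \<and> x i = l (p i)}" (is "subshift ?X")
  unfolding subshift_def
proof
  let ?W = "{p. \<forall>i. p i \<in> E \<and> (p i, p (Suc i)) \<in> r}"
  let ?T = "product_topology (\<lambda>_::nat. discrete_topology UNIV) UNIV"
  have X: "?X = (\<lambda>p i. l (p i)) ` ?W"
    by (auto simp: fun_eq_iff image_iff)
  have cont: "continuous_map ?T cantor_topology (\<lambda>p i. l (p i))"
    unfolding cantor_topology_def continuous_map_componentwise_UNIV
  proof
    fix i
    have "continuous_map ?T (discrete_topology UNIV) (l \<circ> (\<lambda>p. p i))"
      by (rule continuous_map_compose[OF continuous_map_product_projection[of i]]) auto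
    then show "continuous_map ?T (discrete_topology UNIV) (\<lambda>p. l (p i))"
      by (simp add: o_def)
  qed
  have "Hausdorff_space cantor_topology"
    unfolding cantor_topology_def by (simp add: Hausdorff_space_product_topology)
  then show "closedin cantor_topology ?X"
    unfolding X
    by (rule compactin_imp_closedin[OF _ image_compactin[OF compactin_walks[OF assms] cont]])
  show "shift ` ?X \<subseteq> ?X"
  proof safe
    fix x p assume p: "\<forall>i. p i \<in> E \<and> (p i, p (Suc i)) \<in> r \<and> x i = l (p i)"
    show "\<exists>p. \<forall>i. p i \<in> E \<and> (p i, p (Suc i)) \<in> r \<and> shift x i = l (p i)"
      by (rule exI[of _ "\<lambda>i. p (Suc i)"]) (use p in \<open>simp add: shift_def\<close>)
  qed
qed

text \<open>Permits graphs with structured arcs and vertices: injections into the naturals transport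
  them to the type that \<open>sofic_shift\<close> demands.\<close>

lemma sofic_shift_labels:
  fixes hd tl :: "'e \<Rightarrow> 'v" and l :: "'e \<Rightarrow> 'a"
  assumes E: "finite E"
  shows "sofic_shift {x. \<exists>p. \<forall>i. p i \<in> E \<and> hd (p i) = tl (p (Suc i)) \<and> x i = l (p i)}"
    (is "sofic_shift ?X")
  unfolding sofic_shift_def
proof
  show "subshift ?X"
    using subshift_labels[OF E, of "{(a, b). hd a = tl b}" l] by simp
  obtain e :: "'e \<Rightarrow> nat" where e: "inj_on e E"
    using finite_imp_inj_to_nat_seg[OF E] by auto
  have "finite (hd ` E \<union> tl ` E)" using E by simp
  then obtain v :: "'v \<Rightarrow> nat" where v: "inj_on v (hd ` E \<union> tl ` E)"
    using finite_imp_inj_to_nat_seg by metis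
  define d where "d = inv_into E e"
  have d: "d (e a) = a" if "a \<in> E" for a
    using e that by (simp add: d_def)
  define G where "G = \<lparr>verts = v ` (hd ` E \<union> tl ` E), arcs = e ` E,
    tail = \<lambda>a. v (tl (d a)), head = \<lambda>a. v (hd (d a))\<rparr>"
  have "fin_digraph G"
    using E by unfold_locales (auto simp: G_def d)
  moreover have "?X = presented_by G (\<lambda>a. l (d a))"
  proof safe
    fix x p assume p: "\<forall>i. p i \<in> E \<and> hd (p i) = tl (p (Suc i)) \<and> x i = l (p i)"
    show "x \<in> presented_by G (\<lambda>a. l (d a))"
      unfolding presented_by_def
      by (intro CollectI exI[of _ "\<lambda>i. e (p i)"]) (use p in \<open>simp add: G_def d\<close>)
  next
    fix x assume "x \<in> presented_by G (\<lambda>a. l (d a))"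
    then obtain p where p: "\<And>i. p i \<in> e ` E" "\<And>i. v (hd (d (p i))) = v (tl (d (p (Suc i))))"
      "\<And>i. x i = l (d (p i))"
      unfolding presented_by_def by (auto simp: G_def)
    have "d (p i) \<in> E" for i using p(1)[of i] d by auto
    moreover from this have "hd (d (p i)) = tl (d (p (Suc i)))" for i
      by (intro inj_onD[OF v p(2)]) auto
    ultimately show "\<exists>p. \<forall>i. p i \<in> E \<and> hd (p i) = tl (p (Suc i)) \<and> x i = l (p i)"
      using p(3) by (intro exI[of _ "\<lambda>i. d (p i)"]) auto
  qed
  ultimately show "\<exists>(G :: (nat, nat) pre_digraph) l. fin_digraph G \<and> ?X = presented_by G l"
    by blast
qed

lemma shift_invariant_drop:
  assumes "shift ` X \<subseteq> X" "x \<in> X"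
  shows "(\<lambda>k. x (k + i)) \<in> X"
proof (induction i)
  case (Suc i)
  then have "shift (\<lambda>k. x (k + i)) \<in> X" using assms(1) by blast
  then show ?case by (simp add: shift_def)
qed (use assms in simp)

lemma occurs_in_iff_prefix:
  assumes "shift ` X \<subseteq> X"
  shows "occurs_in w X \<longleftrightarrow> (\<exists>x\<in>X. \<forall>k<length w. w ! k = x k)"
proof
  assume "occurs_in w X"
  then obtain x i where x: "x \<in> X" "w = map x [i..<i + length w]"
    unfolding occurs_in_def by blast
  have "w ! k = x (k + i)" if "k < length w" for k
    using that by (subst x(2)) (simp add: add.commute)
  then show "\<exists>x\<in>X. \<forall>k<length w. w ! k = x k"
    using shift_invariant_drop[OF assms x(1), of i] by (intro bexI[of _ "\<lambda>k. x (k + i)"]) auto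
next
  assume "\<exists>x\<in>X. \<forall>k<length w. w ! k = x k"
  then obtain x where "x \<in> X" "\<forall>k<length w. w ! k = x k" by blast
  then show "occurs_in w X"
    unfolding occurs_in_def by (intro bexI[of _ x] exI[of _ 0]) (auto intro: nth_equalityI)
qed

lemma occurs_in_factor:
  assumes "occurs_in (u @ v @ w) X"
  shows "occurs_in v X"
proof -
  obtain x i where x: "x \<in> X" "u @ v @ w = map x [i..<i + length (u @ v @ w)]"
    using assms unfolding occurs_in_def by blast
  have "v = take (length v) (drop (length u) (u @ v @ w))" by simp
  also have "\<dots> = map x [i + length u..<i + length u + length v]"
    by (subst x(2)) (simp add: take_map drop_map del: map_append)
  finally show ?thesis unfolding occurs_in_def using x(1) by blast
qed

text \<open>Otherwise a basic open set around \<open>y\<close> would miss \<open>X\<close>. It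
  restricts finitely many coordinates only, and a prefix of \<open>y\<close> covering them is shared
  with a point of \<open>X\<close>.\<close>

lemma subshift_memberI:
  assumes X: "subshift X" and y: "\<And>n. occurs_in (map y [0..<n]) X"
  shows "y \<in> X"
proof (rule ccontr)
  assume "y \<notin> X"
  have sh: "shift ` X \<subseteq> X" and cl: "closedin cantor_topology X"
    using X unfolding subshift_def by auto
  have top: "topspace cantor_topology = UNIV" by (simp add: cantor_topology_def)
  have "openin cantor_topology (- X)"
    using cl by (simp add: closedin_def top Compl_eq_Diff_UNIV)
  then obtain U where U: "finite {i \<in> UNIV. U i \<noteq> topspace (discrete_topology UNIV)}"
    "y \<in> PiE UNIV U" "PiE UNIV U \<subseteq> - X"
    using \<open>y \<notin> X\<close> unfolding cantor_topology_def openin_product_topology_alt by (metis ComplI)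
  obtain n where n: "\<forall>i\<in>{i. U i \<noteq> UNIV}. i < n"
    using U(1) finite_nat_set_iff_bounded by auto
  obtain x where x: "x \<in> X" "\<forall>k<n. y k = x k"
    using y[of n] unfolding occurs_in_iff_prefix[OF sh] by auto
  have "x i \<in> U i" for i
  proof (cases "U i = UNIV")
    case False
    then have "x i = y i" using n x(2) by auto
    then show ?thesis using U(2) by auto
  qed simp
  then have "x \<in> PiE UNIV U" by auto
  then show False using U(3) x(1) by blast
qed

section \<open>Return words\<close>

lemma sofic_synchronizing_word:
  assumes X: "sofic_shift X" and ne: "X \<noteq> {}"
  obtains w where "occurs_in w X"
    "\<And>u v. occurs_in (u @ w) X \<Longrightarrow> occurs_in (w @ v) X \<Longrightarrow> occurs_in (u @ w @ v) X"
proof -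
  obtain G :: "(nat, nat) pre_digraph" and l where G: "fin_digraph G" "X = presented_by G l"
    using X unfolding sofic_shift_def by blast
  have sh: "shift ` X \<subseteq> X" using X unfolding sofic_shift_def subshift_def by blast
  interpret fin_digraph G by (rule G(1))
  define walk where "walk p \<longleftrightarrow> (\<forall>i. p i \<in> arcs G \<and> head G (p i) = tail G (p (Suc i)))"
    for p :: "nat \<Rightarrow> nat"
  define reads where "reads p w \<longleftrightarrow> (\<forall>k<length w. w ! k = l (p k))" for p w
  define ends where "ends w = {tail G (p (length w)) | p. walk p \<and> reads p w}" for w
  have occurs: "occurs_in w X \<longleftrightarrow> (\<exists>p. walk p \<and> reads p w)" for w
  proof
    assume "occurs_in w X"
    then obtain x where x: "x \<in> X" "\<forall>k<length w. w ! k = x k"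
      using occurs_in_iff_prefix[OF sh] by blast
    then obtain p where "walk p" "\<forall>i. x i = l (p i)"
      unfolding G(2) presented_by_def walk_def by blast
    with x(2) show "\<exists>p. walk p \<and> reads p w" unfolding reads_def by auto
  next
    assume "\<exists>p. walk p \<and> reads p w"
    then obtain p where p: "walk p" "reads p w" by blast
    have "(\<lambda>i. l (p i)) \<in> X" using p(1) unfolding G(2) presented_by_def walk_def by blast
    then show "occurs_in w X"
      using p(2) unfolding occurs_in_iff_prefix[OF sh] reads_def by (intro bexI) auto
  qed
  have walk_drop: "walk (\<lambda>k. p (k + n))" if "walk p" for p n
    using that unfolding walk_def by simp
  have fin: "finite (ends w)" for w
    by (rule finite_subset[of _ "verts G"]) (auto simp: ends_def walk_def)
  have ends_append: "ends (u @ w) \<subseteq> ends w" for u w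
  proof
    fix x assume "x \<in> ends (u @ w)"
    then obtain p where p: "walk p" "reads p (u @ w)" "x = tail G (p (length (u @ w)))"
      unfolding ends_def by blast
    have "reads (\<lambda>k. p (k + length u)) w"
      unfolding reads_def
    proof (intro allI impI)
      fix k assume "k < length w"
      then show "w ! k = l (p (k + length u))"
        using p(2)[unfolded reads_def, rule_format, of "k + length u"] by (simp add: nth_append)
    qed
    then show "x \<in> ends w"
      unfolding ends_def using walk_drop[OF p(1), of "length u"] p(3) by (auto simp: add.commute)
  qed
  have ends_empty: "occurs_in w X \<longleftrightarrow> ends w \<noteq> {}" for w
    unfolding occurs ends_def by auto
  have "occurs_in [] X" using ne unfolding occurs_in_def by auto
  \<comment> \<open>Prolonging a word to the left can only shrink its set of end vertices, so a word whose set
    has minimal size is synchronizing.\<close>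
  then obtain w where w: "occurs_in w X" "\<And>w'. occurs_in w' X \<Longrightarrow> card (ends w) \<le> card (ends w')"
    using ex_has_least_nat[of "\<lambda>w. occurs_in w X" "[]" "\<lambda>w. card (ends w)"] by blast
  have "occurs_in (u @ w @ v) X" if u: "occurs_in (u @ w) X" and v: "occurs_in (w @ v) X" for u v
  proof -
    \<comment> \<open>By minimality every end vertex of \<open>w\<close> is also reached by a walk
      reading \<open>u @ w\<close>, so the part of \<open>p\<close> that reads \<open>v\<close> can
      be grafted onto such a walk.\<close>
    have "ends (u @ w) = ends w"
      using ends_append[of u w] w(2)[OF u] fin by (intro card_seteq)
    moreover obtain p where p: "walk p" "reads p (w @ v)" using v unfolding occurs by blast
    have "reads p w"
      unfolding reads_def
    proof (intro allI impI)
      fix k assume "k < length w"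
      then show "w ! k = l (p k)"
        using p(2)[unfolded reads_def, rule_format, of k] by (simp add: nth_append)
    qed
    then have "tail G (p (length w)) \<in> ends w" using p(1) unfolding ends_def by blast
    ultimately obtain p' where p': "walk p'" "reads p' (u @ w)"
      "tail G (p (length w)) = tail G (p' (length (u @ w)))"
      unfolding ends_def by auto
    let ?n = "length (u @ w)"
    define p'' where "p'' k = (if k < ?n then p' k else p (k - ?n + length w))" for k
    have "walk p''"
      unfolding walk_def
    proof (intro allI conjI)
      fix i
      show "p'' i \<in> arcs G" using p(1) p'(1) unfolding walk_def p''_def by simp
      consider "Suc i < ?n" | "Suc i = ?n" | "?n \<le> i" by linarith
      then show "head G (p'' i) = tail G (p'' (Suc i))"
      proof cases
        case 1
        then show ?thesis using p'(1) unfolding walk_def p''_def by simp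
      next
        case 2
        then have "i < ?n" by simp
        then have "p'' i = p' i" "p'' (Suc i) = p (length w)" using 2 unfolding p''_def by simp_all
        then show ?thesis using p'(1,3) unfolding walk_def 2[symmetric] by simp
      next
        case 3
        then have "Suc i - ?n + length w = Suc (i - ?n + length w)" by simp
        then show ?thesis using p(1) 3 unfolding walk_def p''_def by (simp del: length_append)
      qed
    qed
    moreover have "reads p'' (u @ w @ v)"
      unfolding reads_def
    proof (intro allI impI)
      fix k assume k: "k < length (u @ w @ v)"
      show "(u @ w @ v) ! k = l (p'' k)"
      proof (cases "k < ?n")
        case True
        then have "((u @ w) @ v) ! k = (u @ w) ! k" unfolding nth_append[of "u @ w"] by (simp only: if_True)
        then show ?thesis
          using p'(2) True unfolding reads_def p''_def by (simp del: length_append)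
      next
        case False
        then have "(u @ w @ v) ! k = (w @ v) ! (k - ?n + length w)"
          by (simp add: nth_append)
        also have "\<dots> = l (p (k - ?n + length w))"
          using p(2) k False unfolding reads_def by (auto simp: nth_append)
        finally show ?thesis using False by (simp add: p''_def)
      qed
    qed
    ultimately show ?thesis unfolding occurs by blast
  qed
  with w(1) show ?thesis using that by blast
qed

text \<open>Each return word carries the marker \<open>w\<close> in front only, so that plain
  \<open>concat\<close> joins them and one final \<open>w\<close> closes the sequence.\<close>

definition return_words :: "'a list \<Rightarrow> (nat \<Rightarrow> 'a) set \<Rightarrow> 'a list set" where
  "return_words w X = {r. \<exists>c. r = w @ c \<and> occurs_in (w @ c @ w) X}"

text \<open>Built from the right: the rest followed by \<open>w\<close> always begins with
  \<open>w\<close>, even if the rest is empty, so synchronization attaches one more return word on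
  the left.\<close>

lemma occurs_in_concat_return_words:
  assumes w: "occurs_in w X"
    "\<And>u v. occurs_in (u @ w) X \<Longrightarrow> occurs_in (w @ v) X \<Longrightarrow> occurs_in (u @ w @ v) X"
    and rs: "set rs \<subseteq> return_words w X"
  shows "occurs_in (concat rs @ w) X"
  using rs
proof (induction rs)
  case Nil
  then show ?case using w(1) by simp
next
  case (Cons r rs)
  then obtain c where c: "r = w @ c" "occurs_in (w @ c @ w) X" by (auto simp: return_words_def)
  have IH: "occurs_in (concat rs @ w) X" using Cons by simp
  have "\<exists>v. concat rs @ w = w @ v"
    using Cons.prems by (cases rs) (auto simp: return_words_def)
  then obtain v where v: "concat rs @ w = w @ v" ..
  have "occurs_in ((w @ c) @ w @ v) X" using c(2) IH unfolding v by (intro w(2)) auto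
  then show ?case by (simp add: c(1) v)
qed

text \<open>Mixing places any word \<open>u\<close> between two copies of \<open>w\<close> with
  fillers of exact length \<open>m\<close>. As the fillers have fixed length, \<open>u\<close> can
  be read off from the return word; \<open>C\<close> pays for the marker and both fillers.\<close>

lemma mixing_return_words:
  fixes X :: "(nat \<Rightarrow> 'a::finite) set"
  assumes "mixing X" and w: "occurs_in w X"
  obtains C where "\<And>n. C \<le> n \<Longrightarrow> \<exists>r\<in>return_words w X. length r = n"
    "\<And>n. card {u. length u = n \<and> occurs_in u X} \<le> card {r \<in> return_words w X. length r = n + C}"
proof -
  obtain m where m: "\<And>u v n. occurs_in u X \<Longrightarrow> occurs_in v X \<Longrightarrow> m \<le> n \<Longrightarrow>
      \<exists>c. length c = n \<and> occurs_in (u @ c @ v) X"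
    using assms(1) unfolding mixing_def by blast
  show ?thesis
  proof (rule that[of "length w + 2 * m"])
    fix n assume n: "length w + 2 * m \<le> n"
    then have "m \<le> n - length w" by simp
    from m[OF w w this] obtain c where "length c = n - length w" "occurs_in (w @ c @ w) X"
      by blast
    then show "\<exists>r\<in>return_words w X. length r = n"
      using n by (intro bexI[of _ "w @ c"]) (auto simp: return_words_def)
  next
    fix n
    let ?L = "{u. length u = n \<and> occurs_in u X}"
    let ?R = "{r \<in> return_words w X. length r = n + (length w + 2 * m)}"
    have "\<exists>c c'. length c = m \<and> length c' = m \<and> occurs_in (w @ c @ u @ c' @ w) X"
      if u: "occurs_in u X" for u
    proof -
      obtain c where c: "length c = m" "occurs_in (w @ c @ u) X" using m[OF w u order_refl] by blast
      obtain c' where "length c' = m" "occurs_in ((w @ c @ u) @ c' @ w) X"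
        using m[OF c(2) w order_refl] by blast
      with c(1) show ?thesis by auto
    qed
    then obtain c c' where c: "\<And>u. occurs_in u X \<Longrightarrow> length (c u) = m"
      "\<And>u. occurs_in u X \<Longrightarrow> length (c' u) = m"
      "\<And>u. occurs_in u X \<Longrightarrow> occurs_in (w @ c u @ u @ c' u @ w) X"
      by metis
    have "finite ?R"
      by (rule finite_subset[OF _ finite_lists_length_eq[of UNIV "n + (length w + 2 * m)"]]) auto
    then show "card ?L \<le> card ?R"
    proof (rule card_inj_on_le[of "\<lambda>u. w @ c u @ u @ c' u", rotated -1])
      show "inj_on (\<lambda>u. w @ c u @ u @ c' u) ?L"
        using c(1,2) by (intro inj_onI) auto
      show "(\<lambda>u. w @ c u @ u @ c' u) ` ?L \<subseteq> ?R"
        using c by (auto simp: return_words_def)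
    qed
  qed
qed

text \<open>If the number of words grew at most linearly, its logarithm divided by \<open>n\<close>
  would tend to 0.\<close>

lemma positive_entropy_many_words:
  assumes "entropy X > 0"
  shows "\<exists>n\<ge>1. N * (n + C) < card {w. length w = n \<and> occurs_in w X}"
proof (rule ccontr)
  assume "\<not> ?thesis"
  then have le: "card {w. length w = n \<and> occurs_in w X} \<le> N * (n + C)" if "n \<ge> 1" for n
    using that by (auto simp: not_less)
  let ?e = "\<lambda>n. ln (real (card {w. length w = n \<and> occurs_in w X})) / real n"
  have "?e \<longlonglongrightarrow> 0"
  proof (rule tendsto_sandwich[of "\<lambda>_. 0" _ _ "\<lambda>n. ln (real (Suc N) * (real n + real C)) / real n"])
    show "\<forall>\<^sub>F n in sequentially. 0 \<le> ?e n"
    proof (rule always_eventually, rule allI)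
      fix n
      let ?c = "card {w. length w = n \<and> occurs_in w X}"
      have "0 \<le> ln (real ?c)" by (cases "?c = 0") (simp_all add: ln_ge_zero)
      then show "0 \<le> ?e n" by simp
    qed
    show "\<forall>\<^sub>F n in sequentially. ?e n \<le> ln (real (Suc N) * (real n + real C)) / real n"
      using eventually_ge_at_top[of 1]
    proof eventually_elim
      case (elim n)
      have "real (card {w. length w = n \<and> occurs_in w X}) \<le> real (N * (n + C))"
        using le[OF elim] by (simp only: of_nat_le_iff)
      \<comment> \<open>\<open>Suc N\<close> keeps the argument of the logarithm at least 1 even if
        \<open>N\<close> is 0.\<close>
      also have "\<dots> \<le> real (Suc N) * (real n + real C)"
        by (simp add: algebra_simps)
      finally have *: "real (card {w. length w = n \<and> occurs_in w X}) \<le>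
          real (Suc N) * (real n + real C)" .
      have "1 \<le> real (Suc N) * (real n + real C)"
        using mult_mono[of 1 "real (Suc N)" 1 "real n + real C"] elim by simp
      then have "ln (real (card {w. length w = n \<and> occurs_in w X})) \<le>
          ln (real (Suc N) * (real n + real C))"
        using * by (cases "card {w. length w = n \<and> occurs_in w X} = 0") (simp_all add: ln_ge_zero)
      then show ?case by (rule divide_right_mono) simp
    qed
    show "(\<lambda>n. ln (real (Suc N) * (real n + real C)) / real n) \<longlonglongrightarrow> 0"
      by real_asymp
  qed simp
  then have "entropy X = 0" unfolding entropy_def by (rule limI)
  with assms show False by simp
qed

text \<open>A rotation class has at most \<open>n\<close> members, so \<open>N * n\<close> words
  meet at least \<open>N\<close> classes; one word is chosen from each of \<open>N\<close> of
  them.\<close>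

lemma rotation_classes:
  assumes A: "finite A" "\<And>r. r \<in> A \<Longrightarrow> length r = n" "N * n \<le> card A" "0 < n"
  obtains P where "\<And>j. j < N \<Longrightarrow> P j \<in> A"
    "\<And>i j a b. i < N \<Longrightarrow> j < N \<Longrightarrow> rotate a (P i) = rotate b (P j) \<Longrightarrow> i = j"
proof -
  define c where "c r = range (\<lambda>k. rotate k r)" for r :: "'a list"
  have c_rotate: "c (rotate a r) = c r" if "length r = n" for a r
  proof -
    have "rotate k r \<in> c (rotate a r)" for k
    proof -
      have "rotate k r = rotate (k + a * n) r"
        by (subst (1 2) rotate_conv_mod) (simp add: that)
      \<comment> \<open>On words of length \<open>n\<close>, rotating by \<open>a * (n - 1)\<close>
        undoes the rotation by \<open>a\<close>.\<close>
      also have "k + a * n = (k + a * (n - 1)) + a"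
        using A(4) by (cases n) auto
      finally have "rotate k r = rotate (k + a * (n - 1)) (rotate a r)" by (simp only: rotate_rotate)
      then show ?thesis unfolding c_def by (rule range_eqI)
    qed
    moreover have "rotate k (rotate a r) \<in> c r" for k unfolding c_def by (simp add: rotate_rotate)
    ultimately show ?thesis
      unfolding c_def[of r] c_def[of "rotate a r"] by blast
  qed
  have card_c: "finite (c r) \<and> card (c r) \<le> n" if "length r = n" for r
  proof -
    have "c r = (\<lambda>k. rotate k r) ` {..<n}"
    proof -
      have "rotate k r \<in> (\<lambda>k. rotate k r) ` {..<n}" for k
        using A(4) that by (intro image_eqI[of _ _ "k mod n"]) (auto simp: rotate_conv_mod[of k])
      then show ?thesis unfolding c_def by auto
    qed
    then show ?thesis using card_image_le[of "{..<n}" "\<lambda>k. rotate k r"] by simp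
  qed
  have self: "r \<in> c r" for r unfolding c_def by (rule range_eqI[of _ _ 0]) simp
  have 1: "card A \<le> card (\<Union>Z\<in>c ` A. Z)"
    using A(1,2) card_c self by (intro card_mono) auto
  also have "\<dots> \<le> (\<Sum>Z\<in>c ` A. card Z)" by (rule card_UN_le) (use A in simp)
  also have "\<dots> \<le> (\<Sum>Z\<in>c ` A. n)" using card_c A(2) by (intro sum_mono) auto
  also have "\<dots> = card (c ` A) * n" by simp
  finally have "N * n \<le> card (c ` A) * n" using A(3) 1 by linarith
  then have "card {..<N} \<le> card (c ` A)" using A(4) by simp
  then obtain Q where Q: "Q ` {..<N} \<subseteq> c ` A" "inj_on Q {..<N}"
    using card_le_inj[of "{..<N}" "c ` A"] A(1) by blast
  then have "\<forall>j\<in>{..<N}. \<exists>r\<in>A. Q j = c r" by blast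
  then obtain P where P: "\<And>j. j < N \<Longrightarrow> P j \<in> A \<and> Q j = c (P j)"
    by (metis lessThan_iff)
  show ?thesis
  proof (rule that[of P])
    fix i j a b assume ij: "i < N" "j < N" "rotate a (P i) = rotate b (P j)"
    then have "c (P i) = c (P j)" using c_rotate P A(2) by metis
    then show "i = j" using inj_onD[OF Q(2), of i j] ij P by auto
  qed (use P in blast)
qed

section \<open>Coded subshifts\<close>

text \<open>One connecting length \<open>b\<close> for all pairs keeps the pasted walk in step with
  the positions: each connection fills exactly one block and nothing is displaced.\<close>

lemma glue_walks:
  assumes conn: "\<And>a a'. a \<in> E \<Longrightarrow> a' \<in> E \<Longrightarrow> (a, a') \<in> r ^^ b" and b: "0 < b"
    and P: "\<And>k i. P k i \<in> E \<and> (P k i, P k (Suc i)) \<in> r"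
    and \<sigma>: "udens {i. \<sigma> i \<noteq> \<sigma> (Suc i)} = 0"
  obtains p where "\<And>i. (p i, p (Suc i)) \<in> r" "udens {i. p i \<noteq> P (\<sigma> i) i} = 0"
proof -
  \<comment> \<open>On blocks of length \<open>b\<close> where \<open>\<sigma>\<close> is constant keep the selected walk, and on the others
    take a connecting walk of length \<open>b\<close>.\<close>
  define start where "start j = P (\<sigma> (j * b)) (j * b)" for j
  define const where "const j \<longleftrightarrow> (\<forall>t<b. \<sigma> (j * b + t) = \<sigma> (Suc (j * b + t)))" for j
  \<comment> \<open>The case \<open>t = b\<close> is included: it makes a kept block end where the
    next block starts.\<close>
  have const: "\<sigma> (j * b + t) = \<sigma> (j * b)" if "const j" "t \<le> b" for j t
    using that(2)
  proof (induction t)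
    case (Suc t)
    then show ?case using that(1) unfolding const_def by simp
  qed simp
  have "\<exists>c. c 0 = start j \<and> c b = start (Suc j) \<and> (\<forall>t<b. (c t, c (Suc t)) \<in> r) \<and>
      (const j \<longrightarrow> (\<forall>t<b. c t = P (\<sigma> (j * b + t)) (j * b + t)))" for j
  proof (cases "const j")
    case True
    then show ?thesis
      using P const[OF True] const[OF True, of b]
      by (intro exI[of _ "\<lambda>t. P (\<sigma> (j * b)) (j * b + t)"]) (simp add: start_def add.commute)
  next
    case False
    have "(start j, start (Suc j)) \<in> r ^^ b" using conn P unfolding start_def by blast
    then show ?thesis using False unfolding relpow_fun_conv by auto
  qed
  then obtain c where c: "\<And>j. c j 0 = start j" "\<And>j. c j b = start (Suc j)"
    "\<And>j t. t < b \<Longrightarrow> (c j t, c j (Suc t)) \<in> r"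
    "\<And>j t. const j \<Longrightarrow> t < b \<Longrightarrow> c j t = P (\<sigma> (j * b + t)) (j * b + t)"
    by metis
  define p where "p i = c (i div b) (i mod b)" for i
  have "(p i, p (Suc i)) \<in> r" for i
  proof -
    have m: "i mod b < b" using b by simp
    have "p (Suc i) = c (i div b) (Suc (i mod b))"
    proof (cases "Suc (i mod b) = b")
      case True
      then have "Suc i mod b = 0" "Suc i div b = Suc (i div b)"
        by (simp_all add: mod_Suc div_Suc)
      then show ?thesis using c(1,2) True by (simp add: p_def)
    next
      case False
      then have "Suc i mod b = Suc (i mod b)" "Suc i div b = i div b"
        by (auto simp: mod_Suc div_Suc)
      then show ?thesis by (simp add: p_def)
    qed
    then show ?thesis using c(3)[OF m] by (simp add: p_def)
  qed
  moreover have "udens {i. p i \<noteq> P (\<sigma> i) i} \<le> 0"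
  proof -
    \<comment> \<open>A deviating position shares its block with a change of
      \<open>\<sigma>\<close>, hence lies at distance less than \<open>b\<close> from a set of
      density 0.\<close>
    have "{i. p i \<noteq> P (\<sigma> i) i} \<subseteq>
        {i. \<exists>a\<in>{i. \<sigma> i \<noteq> \<sigma> (Suc i)}. a < i + b \<and> i < a + b}"
    proof
      fix i assume i: "i \<in> {i. p i \<noteq> P (\<sigma> i) i}"
      have m: "i mod b < b" using b by simp
      have split: "i div b * b + i mod b = i" by simp
      have "\<not> const (i div b)"
        using c(4)[OF _ m, of "i div b"] i unfolding p_def split by auto
      then obtain t where t: "t < b" "\<sigma> (i div b * b + t) \<noteq> \<sigma> (Suc (i div b * b + t))"
        unfolding const_def by blast
      show "i \<in> {i. \<exists>a\<in>{i. \<sigma> i \<noteq> \<sigma> (Suc i)}. a < i + b \<and> i < a + b}"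
      proof (rule CollectI, rule bexI[of _ "i div b * b + t"], rule conjI)
        show "i div b * b + t < i + b" "i < i div b * b + t + b" using t m split by linarith+
      qed (use t in simp)
    qed
    then have "udens {i. p i \<noteq> P (\<sigma> i) i} \<le>
        udens {i. \<exists>a\<in>{i. \<sigma> i \<noteq> \<sigma> (Suc i)}. a < i + b \<and> i < a + b}"
      by (rule udens_mono)
    also have "\<dots> = 0" by (rule udens_thicken_0[OF \<sigma>])
    finally show ?thesis .
  qed
  ultimately show ?thesis by (intro that) (auto intro: antisym)
qed

text \<open>The quotient of \<open>n\<close> by \<open>L\<close> is at least the remainder, so the
  remainder is absorbed by lengthening that many pieces from \<open>L\<close> to
  \<open>L + 1\<close>.\<close>

lemma consecutive_lengths_generate:
  fixes L n :: nat
  assumes "0 < L" "L * L \<le> n"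
  shows "\<exists>x y. n = x * L + y * (L + 1)"
proof -
  have "L \<le> n div L" using assms by (simp add: less_eq_div_iff_mult_less_eq)
  moreover have "n mod L < L" using assms by simp
  ultimately have "n mod L \<le> n div L" by simp
  then obtain d where "n div L = n mod L + d" using le_Suc_ex by blast
  then have "n = (n mod L + d) * L + n mod L" using div_mult_mod_eq[of n L] by simp
  then have "n = d * L + n mod L * (L + 1)" by (simp add: algebra_simps)
  then show ?thesis by blast
qed

section \<open>The coded subshift of a vertex set: its graph, gluing and soficity\<close>

locale marker_code =
  fixes N l :: nat and P :: "nat \<Rightarrow> 'a list" and q :: "'a list"
  assumes l_pos: "0 < l"
    and length_P: "\<And>j. j < N \<Longrightarrow> length (P j) = l"
    and length_q: "length q = l + 1"
    and rotate_P: "\<And>i j a b. i < N \<Longrightarrow> j < N \<Longrightarrow> rotate a (P i) = rotate b (P j) \<Longrightarrow> i = j"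
begin

text \<open>Four copies of \<open>P v\<close> make every code word contain a full window of length
  \<open>3 * l + 1\<close>. The last slot varies the length by one, so the two lengths are
  coprime.\<close>

definition code_word :: "nat \<Rightarrow> bool \<Rightarrow> 'a list" where
  "code_word v s = P v @ P v @ P v @ P v @ (if s then q else P v)"

definition code_length :: "bool \<Rightarrow> nat" where
  "code_length s = 5 * l + of_bool s"

lemma length_code_word: "v < N \<Longrightarrow> length (code_word v s) = code_length s"
  by (simp add: code_word_def code_length_def length_P length_q)

lemma code_length_pos: "0 < code_length s"
  using l_pos by (simp add: code_length_def)

lemma code_length_le: "code_length s \<le> 5 * l + 1"
  by (simp add: code_length_def)

lemma code_word_run:
  assumes v: "v < N" and j: "j < 4 * l"
  shows "code_word v s ! j = P v ! (j mod l)"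
proof -
  have "j < l \<or> l \<le> j \<and> j < 2 * l \<or> 2 * l \<le> j \<and> j < 3 * l \<or> 3 * l \<le> j"
    by linarith
  then consider "j < l" | k where "j = l + k" "k < l" | k where "j = l + (l + k)" "k < l"
    | k where "j = l + (l + (l + k))" "k < l"
  proof (elim disjE conjE)
    assume "l \<le> j" "j < 2 * l"
    then show ?thesis by (intro that(2)[of "j - l"]) auto
  next
    assume "2 * l \<le> j" "j < 3 * l"
    then show ?thesis by (intro that(3)[of "j - 2 * l"]) auto
  next
    assume "3 * l \<le> j"
    then show ?thesis using j by (intro that(4)[of "j - 3 * l"]) auto
  qed (use that(1) in blast)
  then show ?thesis
    by cases (simp_all add: code_word_def nth_append length_P[OF v])
qed

text \<open>The arc \<open>(v, s, j)\<close> reads letter \<open>j\<close> of \<open>code_word v s\<close>. Vertices are triples too: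
  \<open>(0, False, 0)\<close> is the vertex between code words, and \<open>(v, s, j)\<close> with \<open>j > 0\<close> is the
  vertex before letter \<open>j\<close>.\<close>

definition arcs_over :: "nat set \<Rightarrow> (nat \<times> bool \<times> nat) set" where
  "arcs_over T = {(v, s, j). v \<in> T \<and> j < code_length s}"

definition arc_tail :: "nat \<times> bool \<times> nat \<Rightarrow> nat \<times> bool \<times> nat" where
  "arc_tail = (\<lambda>(v, s, j). if j = 0 then (0, False, 0) else (v, s, j))"

definition arc_head :: "nat \<times> bool \<times> nat \<Rightarrow> nat \<times> bool \<times> nat" where
  "arc_head = (\<lambda>(v, s, j). if Suc j < code_length s then (v, s, Suc j) else (0, False, 0))"

definition arc_label :: "nat \<times> bool \<times> nat \<Rightarrow> 'a" where
  "arc_label = (\<lambda>(v, s, j). code_word v s ! j)"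

definition step :: "nat set \<Rightarrow> ((nat \<times> bool \<times> nat) \<times> (nat \<times> bool \<times> nat)) set" where
  "step T = {(a, b). a \<in> arcs_over T \<and> b \<in> arcs_over T \<and> arc_head a = arc_tail b}"

definition code_walk :: "nat set \<Rightarrow> (nat \<Rightarrow> nat \<times> bool \<times> nat) \<Rightarrow> bool" where
  "code_walk T p \<longleftrightarrow> (\<forall>i. (p i, p (Suc i)) \<in> step T)"

definition code_shift :: "nat set \<Rightarrow> (nat \<Rightarrow> 'a) set" where
  "code_shift T = {\<lambda>i. arc_label (p i) | p. code_walk T p}"

lemma step_inside: "v \<in> T \<Longrightarrow> Suc j < code_length s \<Longrightarrow> ((v, s, j), (v, s, Suc j)) \<in> step T"
  by (simp add: step_def arcs_over_def arc_head_def arc_tail_def)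

lemma step_next:
  "v \<in> T \<Longrightarrow> v' \<in> T \<Longrightarrow> Suc j = code_length s \<Longrightarrow> ((v, s, j), (v', s', 0)) \<in> step T"
  using code_length_pos by (simp add: step_def arcs_over_def arc_head_def arc_tail_def)

lemma step_insideD: "((v, s, j), b) \<in> step T \<Longrightarrow> Suc j < code_length s \<Longrightarrow> b = (v, s, Suc j)"
  by (auto simp: step_def arc_head_def arc_tail_def split: prod.splits if_splits)

lemma step_nextD: "((v, s, j), b) \<in> step T \<Longrightarrow> \<not> Suc j < code_length s \<Longrightarrow> \<exists>v' s'. b = (v', s', 0)"
  by (auto simp: step_def arc_head_def arc_tail_def split: prod.splits if_splits)

lemma relpow_inside:
  "v \<in> T \<Longrightarrow> j + t < code_length s \<Longrightarrow> ((v, s, j), (v, s, j + t)) \<in> step T ^^ t"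
proof (induction t)
  case (Suc t)
  then have "((v, s, j), (v, s, j + t)) \<in> step T ^^ t" by simp
  moreover have "((v, s, j + t), (v, s, Suc (j + t))) \<in> step T"
    using Suc.prems by (intro step_inside) auto
  ultimately show ?case by auto
qed simp

lemma relpow_to_next:
  assumes "v \<in> T" "v' \<in> T" "j < code_length s"
  shows "((v, s, j), (v', s', 0)) \<in> step T ^^ (code_length s - j)"
proof -
  let ?t = "code_length s - Suc j"
  have "((v, s, j), (v, s, j + ?t)) \<in> step T ^^ ?t" using assms by (intro relpow_inside) auto
  moreover have "((v, s, j + ?t), (v', s', 0)) \<in> step T" using assms by (intro step_next) auto
  ultimately have "((v, s, j), (v', s', 0)) \<in> step T ^^ Suc ?t" by auto
  moreover have "Suc ?t = code_length s - j" using assms(3) by simp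
  ultimately show ?thesis by simp
qed

text \<open>An arc at letter 0 already commits to a code word by its flag. The loops are therefore
  prepended one at a time to the given end, and the initial flag \<open>s0\<close> is whatever word
  comes first.\<close>

lemma relpow_loops:
  assumes "v \<in> T"
  shows "\<exists>s0. ((v, s0, 0), (v, s, 0)) \<in> step T ^^ (x * (5 * l) + y * (5 * l + 1))"
proof (induction x)
  case 0
  show ?case
  proof (induction y)
    case 0
    show ?case by (intro exI[of _ s]) simp
  next
    case (Suc y)
    then obtain s0 where "((v, s0, 0), (v, s, 0)) \<in> step T ^^ (y * (5 * l + 1))" by auto
    moreover have "((v, True, 0), (v, s0, 0)) \<in> step T ^^ (5 * l + 1)"
      using relpow_to_next[OF assms assms, of 0 True s0] code_length_pos
      by (simp add: code_length_def)
    ultimately have "((v, True, 0), (v, s, 0)) \<in> step T ^^ ((5 * l + 1) + y * (5 * l + 1))"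
      unfolding relpow_add by blast
    then show ?case by (auto simp: algebra_simps)
  qed
next
  case (Suc x)
  then obtain s0 where "((v, s0, 0), (v, s, 0)) \<in> step T ^^ (x * (5 * l) + y * (5 * l + 1))" ..
  moreover have "((v, False, 0), (v, s0, 0)) \<in> step T ^^ (5 * l)"
    using relpow_to_next[OF assms assms, of 0 False s0] code_length_pos[of False]
    by (simp add: code_length_def)
  ultimately have "((v, False, 0), (v, s, 0)) \<in>
      step T ^^ (5 * l + (x * (5 * l) + y * (5 * l + 1)))"
    unfolding relpow_add by blast
  then show ?case by (auto simp: algebra_simps)
qed

lemma arcs_over_connected:
  "\<exists>b>0. \<forall>a\<in>arcs_over T. \<forall>a'\<in>arcs_over T. (a, a') \<in> step T ^^ b"
proof (intro exI conjI ballI)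
  let ?L = "5 * l"
  \<comment> \<open>From \<open>?L * ?L\<close> on, every length is a sum of code word lengths. The
    rest pays for finishing the current word, one word leading from \<open>v\<close> to
    \<open>v'\<close>, and the first \<open>j'\<close> letters of the target word; loops at
    \<open>v\<close> fill the remainder \<open>n\<close>.\<close>
  let ?b = "?L * ?L + 3 * (?L + 1)"
  show "0 < ?b" by simp
  fix a a' assume "a \<in> arcs_over T" "a' \<in> arcs_over T"
  then obtain v s j v' s' j' where a: "a = (v, s, j)" "v \<in> T" "j < code_length s"
    and a': "a' = (v', s', j')" "v' \<in> T" "j' < code_length s'"
    by (auto simp: arcs_over_def)
  define n where "n = ?b - (code_length s - j) - ?L - j'"
  have le: "(code_length s - j) + ?L + j' \<le> 3 * (?L + 1)"
  proof -
    have "code_length s - j \<le> ?L + 1" by (rule order_trans[OF diff_le_self code_length_le])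
    moreover have "j' \<le> ?L + 1" using a'(3) code_length_le[of s'] by simp
    ultimately show ?thesis by simp
  qed
  then have n: "?L * ?L \<le> n" "?b = (code_length s - j) + (n + (?L + j'))"
    unfolding n_def by linarith+
  obtain x y where "n = x * ?L + y * (?L + 1)"
    using consecutive_lengths_generate[OF _ n(1)] l_pos by auto
  then obtain s0 where s0: "((v, s0, 0), (v, False, 0)) \<in> step T ^^ n"
    using relpow_loops[OF a(2), of False x y] by auto
  have "((v, s, j), (v, s0, 0)) \<in> step T ^^ (code_length s - j)"
    using a by (intro relpow_to_next)
  moreover have "((v, False, 0), (v', s', 0)) \<in> step T ^^ ?L"
    using relpow_to_next[OF a(2) a'(2), of 0 False s'] code_length_pos[of False]
    by (simp add: code_length_def)
  moreover have "((v', s', 0), (v', s', j')) \<in> step T ^^ j'"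
    using relpow_inside[OF a'(2), of 0 j' s'] a'(3) by simp
  ultimately show "(a, a') \<in> step T ^^ ?b"
    unfolding n(2) relpow_add a(1) a'(1) using s0 by blast
qed

lemma code_walk_arcs: "code_walk T p \<Longrightarrow> p i \<in> arcs_over T"
  by (auto simp: code_walk_def step_def)

text \<open>Gluing happens at the level of arcs, where connectedness is available; labels disagree
  at most where arcs do.\<close>

lemma code_shift_glue:
  assumes P: "\<And>k. P' k \<in> code_shift T" and \<sigma>: "udens {i. \<sigma> i \<noteq> \<sigma> (Suc i)} = 0"
  shows "\<exists>r\<in>code_shift T. bdist r (\<lambda>i. P' (\<sigma> i) i) = 0"
proof -
  have "\<exists>p. code_walk T p \<and> P' k = (\<lambda>i. arc_label (p i))" for k
    using P[of k] unfolding code_shift_def by blast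
  then obtain p where p: "\<And>k. code_walk T (p k)" "\<And>k. P' k = (\<lambda>i. arc_label (p k i))"
    by metis
  obtain b where b: "0 < b" "\<forall>a\<in>arcs_over T. \<forall>a'\<in>arcs_over T. (a, a') \<in> step T ^^ b"
    using arcs_over_connected by blast
  have steps: "p k i \<in> arcs_over T \<and> (p k i, p k (Suc i)) \<in> step T" for k i
    using p(1)[of k] code_walk_arcs unfolding code_walk_def by blast
  obtain w where w: "\<And>i. (w i, w (Suc i)) \<in> step T" "udens {i. w i \<noteq> p (\<sigma> i) i} = 0"
    using glue_walks[where E = "arcs_over T" and r = "step T" and b = b and P = p and \<sigma> = \<sigma>] b steps \<sigma>
    by blast
  have "(\<lambda>i. arc_label (w i)) \<in> code_shift T"
    using w(1) unfolding code_shift_def code_walk_def by blast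
  moreover have "bdist (\<lambda>i. arc_label (w i)) (\<lambda>i. P' (\<sigma> i) i) \<le> udens {i. w i \<noteq> p (\<sigma> i) i}"
    unfolding bdist_udens p(2) by (rule udens_mono) auto
  ultimately show ?thesis using w(2) by (intro bexI) (auto intro: antisym)
qed

text \<open>Supplies the vertex points of the homotopy equivalence: every code word used is five
  copies of \<open>P v\<close>, whatever \<open>T\<close> is.\<close>

lemma periodic_in_code_shift:
  assumes "v \<in> T"
  shows "(\<lambda>i. code_word v False ! (i mod code_length False)) \<in> code_shift T"
proof -
  define p where "p i = (v, False, i mod code_length False)" for i
  have "(p i, p (Suc i)) \<in> step T" for i
  proof (cases "Suc (i mod code_length False) = code_length False")
    case True
    then have "Suc i mod code_length False = 0" by (simp add: mod_Suc)
    then show ?thesis unfolding p_def using step_next[OF assms assms True, of False] by simp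
  next
    case False
    then have "Suc i mod code_length False = Suc (i mod code_length False)" by (simp add: mod_Suc)
    moreover have "Suc (i mod code_length False) < code_length False"
      using False code_length_pos[of False] mod_less_divisor[of "code_length False" i] by linarith
    ultimately show ?thesis unfolding p_def using step_inside[OF assms] by simp
  qed
  then show ?thesis
    unfolding code_shift_def code_walk_def
    by (intro CollectI exI[of _ p]) (auto simp: p_def arc_label_def)
qed

text \<open>The graphs of different \<open>T\<close> overlap, so a disjoint union is formed: arcs
  are tagged by \<open>T\<close>, and heads and tails keep the tag, which confines each walk to one
  simplex.\<close>

lemma sofic_Union_code_shift:
  assumes "finite \<T>" "\<And>T. T \<in> \<T> \<Longrightarrow> finite T"
  shows "sofic_shift (\<Union>T\<in>\<T>. code_shift T)"
proof -
  let ?E = "Sigma \<T> arcs_over"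
  let ?X = "{x. \<exists>p. \<forall>i. p i \<in> ?E \<and> apsnd arc_head (p i) = apsnd arc_tail (p (Suc i)) \<and>
      x i = arc_label (snd (p i))}"
  have sub: "arcs_over T \<subseteq> T \<times> (UNIV \<times> {..<5 * l + 1})" for T
    using code_length_le by (auto simp: arcs_over_def less_le_trans)
  have "finite (arcs_over T)" if "T \<in> \<T>" for T
    by (rule finite_subset[OF sub]) (use assms(2)[OF that] in simp)
  then have "finite ?E" by (intro finite_SigmaI assms(1))
  then have "sofic_shift ?X" by (rule sofic_shift_labels)
  also have "?X = (\<Union>T\<in>\<T>. code_shift T)"
  proof safe
    fix x p assume p: "\<forall>i. p i \<in> ?E \<and> apsnd arc_head (p i) = apsnd arc_tail (p (Suc i)) \<and>
      x i = arc_label (snd (p i))"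
    define T where "T = fst (p 0)"
    have T: "fst (p i) = T" for i
    proof (induction i)
      case (Suc i)
      have "fst (apsnd arc_head (p i)) = fst (apsnd arc_tail (p (Suc i)))" using p by simp
      then show ?case using Suc by simp
    qed (simp add: T_def)
    have snd: "snd (p i) \<in> arcs_over T" "arc_head (snd (p i)) = arc_tail (snd (p (Suc i)))" for i
    proof -
      have "p i \<in> ?E" using p by blast
      then show "snd (p i) \<in> arcs_over T" using T[of i] by (cases "p i") auto
      have "snd (apsnd arc_head (p i)) = snd (apsnd arc_tail (p (Suc i)))" using p by simp
      then show "arc_head (snd (p i)) = arc_tail (snd (p (Suc i)))" by simp
    qed
    have "p 0 \<in> ?E" using p by blast
    then have "T \<in> \<T>" unfolding T_def by auto
    moreover have "x = (\<lambda>i. arc_label (snd (p i)))" using p by auto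
    then have "x \<in> code_shift T"
      unfolding code_shift_def code_walk_def using snd
      by (intro CollectI exI[of _ "\<lambda>i. snd (p i)"]) (simp add: step_def)
    ultimately show "x \<in> (\<Union>T\<in>\<T>. code_shift T)" by blast
  next
    fix x T assume T: "T \<in> \<T>" "x \<in> code_shift T"
    then obtain p where "code_walk T p" "x = (\<lambda>i. arc_label (p i))" unfolding code_shift_def by blast
    with T(1) show "\<exists>p. \<forall>i. p i \<in> ?E \<and> apsnd arc_head (p i) = apsnd arc_tail (p (Suc i)) \<and>
        x i = arc_label (snd (p i))"
      by (intro exI[of _ "\<lambda>i. (T, p i)"]) (auto simp: code_walk_def step_def)
  qed
  finally show ?thesis .
qed

end

section \<open>Run densities as vertex detectors, and inclusion in the ambient shift\<close>

context marker_code
begin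

text \<open>A window of length \<open>3 * l + 1\<close> always contains \<open>l\<close> consecutive letters of some run
  \<open>P v @ P v @ P v @ P v\<close> and fits inside such a run.\<close>

definition run_positions :: "nat \<Rightarrow> (nat \<Rightarrow> 'a) \<Rightarrow> nat set" where
  "run_positions j y = {i. \<exists>r. \<forall>t<3 * l + 1. y (i + t) = P j ! ((r + t) mod l)}"

definition run_density :: "nat \<Rightarrow> (nat \<Rightarrow> 'a) \<Rightarrow> real" where
  "run_density j y = udens (run_positions j y)"

lemma run_density_nonneg: "0 \<le> run_density j y"
  by (simp add: run_density_def)

text \<open>A position can change status only if the two points differ inside its window of length
  \<open>3 * l + 1\<close>.\<close>

lemma run_density_lipschitz: "\<bar>run_density j y - run_density j z\<bar> \<le> real (3 * l + 1) * bdist y z"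
proof -
  have *: "run_density j y \<le> run_density j z + real (3 * l + 1) * bdist y z" for y z
  proof -
    have "run_positions j y \<subseteq> run_positions j z \<union> {i. \<exists>t<3 * l + 1. i + t \<in> {i. y i \<noteq> z i}}"
    proof
      fix i assume i: "i \<in> run_positions j y"
      show "i \<in> run_positions j z \<union> {i. \<exists>t<3 * l + 1. i + t \<in> {i. y i \<noteq> z i}}"
      proof (cases "\<exists>t<3 * l + 1. y (i + t) \<noteq> z (i + t)")
        case False
        then show ?thesis using i by (auto simp: run_positions_def)
      qed simp
    qed
    then have "run_density j y \<le> udens (run_positions j z) + udens {i. \<exists>t<3 * l + 1. i + t \<in> {i. y i \<noteq> z i}}"
      unfolding run_density_def by (rule order_trans[OF udens_mono udens_Un])
    also have "udens {i. \<exists>t<3 * l + 1. i + t \<in> {i. y i \<noteq> z i}} \<le> real (3 * l + 1) * bdist y z"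
      unfolding bdist_udens by (rule udens_prethicken)
    finally show ?thesis by (simp add: run_density_def)
  qed
  show ?thesis using *[of y z] *[of z y] bdist_commute[of y z] by simp
qed

lemma code_walk_step: "code_walk T p \<Longrightarrow> p i = a \<Longrightarrow> (a, p (Suc i)) \<in> step T"
  by (auto simp: code_walk_def)

lemma code_walk_advance:
  assumes p: "code_walk T p" "p i = (v, s, j)" and t: "j + t < code_length s"
  shows "p (i + t) = (v, s, j + t)"
  using t
proof (induction t)
  case (Suc t)
  then have "p (i + t) = (v, s, j + t)" by simp
  then have "((v, s, j + t), p (Suc (i + t))) \<in> step T" by (rule code_walk_step[OF p(1)])
  then have "p (Suc (i + t)) = (v, s, Suc (j + t))" using Suc.prems by (intro step_insideD) auto
  then show ?case by simp
qed (use p in simp)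

lemma code_walk_next_word:
  assumes p: "code_walk T p" "p i = (v, s, j)" and j: "j < code_length s"
  shows "\<exists>v' s'. p (i + (code_length s - j)) = (v', s', 0)"
proof -
  let ?t = "code_length s - Suc j"
  have "p (i + ?t) = (v, s, j + ?t)" using j by (intro code_walk_advance[OF p]) simp
  then have "((v, s, j + ?t), p (Suc (i + ?t))) \<in> step T" by (rule code_walk_step[OF p(1)])
  then have "\<exists>v' s'. p (Suc (i + ?t)) = (v', s', 0)" using j by (intro step_nextD) auto
  moreover have "Suc (i + ?t) = i + (code_length s - j)" using j by simp
  ultimately show ?thesis by (simp only:)
qed

lemma code_walk_run:
  assumes T: "T \<subseteq> {..<N}" and p: "code_walk T p" "p i = (v, s, j)" and t: "j + t < 4 * l"
  shows "arc_label (p (i + t)) = P v ! ((j + t) mod l)"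
proof -
  have "v \<in> T" using code_walk_arcs[OF p(1), of i] p(2) by (simp add: arcs_over_def)
  then have v: "v < N" using T by blast
  have "j + t < code_length s" using t by (simp add: code_length_def)
  from code_walk_advance[OF p this] show ?thesis
    using code_word_run[OF v t] by (simp add: arc_label_def)
qed

text \<open>Either \<open>l\<close> letters of the fourfold run in the current code word are still
  ahead, or the next code word starts within \<open>2 * l + 1\<close> letters.\<close>

lemma code_walk_find_run:
  assumes T: "T \<subseteq> {..<N}" and p: "code_walk T p"
  shows "\<exists>d\<le>2 * l + 1. \<exists>v\<in>T. \<exists>r. \<forall>t<l. arc_label (p (i + d + t)) = P v ! ((r + t) mod l)"
proof -
  obtain v s j where vsj: "p i = (v, s, j)" by (cases "p i")
  have v: "v \<in> T" and j: "j < code_length s"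
    using code_walk_arcs[OF p, of i] vsj by (auto simp: arcs_over_def)
  show ?thesis
  proof (cases "j + l \<le> 4 * l")
    case True
    have "\<forall>t<l. arc_label (p (i + 0 + t)) = P v ! ((j + t) mod l)"
      using code_walk_run[OF T p vsj] True by simp
    then show ?thesis using v by (intro exI[of _ 0]) blast
  next
    case False
    let ?d = "code_length s - j"
    have d: "?d \<le> 2 * l + 1" using False code_length_le[of s] by linarith
    obtain v' s' where next': "p (i + ?d) = (v', s', 0)" using code_walk_next_word[OF p vsj j] by blast
    then have "v' \<in> T" using code_walk_arcs[OF p, of "i + ?d"] by (auto simp: arcs_over_def)
    moreover have "\<forall>t<l. arc_label (p (i + ?d + t)) = P v' ! ((0 + t) mod l)"
      using code_walk_run[OF T p next'] by simp
    ultimately show ?thesis using d by blast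
  qed
qed

text \<open>A window of \<open>P j\<close> would contain \<open>l\<close> letters from a run of some
  \<open>P v\<close> with \<open>v\<close> in \<open>T\<close>. Any \<open>l\<close> consecutive
  letters of a sequence of period \<open>l\<close> form a rotation of the period, so
  \<open>P j\<close> and \<open>P v\<close> would be conjugate.\<close>

lemma run_positions_empty:
  assumes T: "T \<subseteq> {..<N}" and y: "y \<in> code_shift T" and j: "j < N" "j \<notin> T"
  shows "run_positions j y = {}"
proof (rule ccontr)
  assume "run_positions j y \<noteq> {}"
  then obtain i r where r: "\<And>t. t < 3 * l + 1 \<Longrightarrow> y (i + t) = P j ! ((r + t) mod l)"
    by (auto simp: run_positions_def)
  obtain p where p: "code_walk T p" "y = (\<lambda>i. arc_label (p i))"
    using y unfolding code_shift_def by blast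
  obtain d v r' where d: "d \<le> 2 * l + 1" "v \<in> T"
    "\<And>t. t < l \<Longrightarrow> arc_label (p (i + d + t)) = P v ! ((r' + t) mod l)"
    using code_walk_find_run[OF T p(1), of i] by blast
  have v: "v < N" using d(2) T by blast
  have "rotate (r + d) (P j) = rotate r' (P v)"
  proof (rule nth_equalityI)
    show "length (rotate (r + d) (P j)) = length (rotate r' (P v))"
      by (simp add: length_P v j)
    fix t assume "t < length (rotate (r + d) (P j))"
    then have t: "t < l" by (simp add: length_P j)
    have "P j ! ((r + (d + t)) mod l) = y (i + (d + t))" using r[of "d + t"] t d(1) by simp
    also have "\<dots> = P v ! ((r' + t) mod l)" using d(3)[OF t] p(2) by (simp add: add.assoc)
    finally show "rotate (r + d) (P j) ! t = rotate r' (P v) ! t"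
      using t by (simp add: nth_rotate length_P v j(1) add.assoc)
  qed
  then have "j = v" using rotate_P j(1) v by blast
  with j(2) d(2) show False by simp
qed

lemma run_density_outside:
  "T \<subseteq> {..<N} \<Longrightarrow> y \<in> code_shift T \<Longrightarrow> j < N \<Longrightarrow> j \<notin> T \<Longrightarrow> run_density j y = 0"
  by (simp add: run_density_def run_positions_empty)

text \<open>Some code word starts at most \<open>5 * l + 1\<close> steps after any position, and its
  start is a run position. If all densities were 0, finitely many sets of density 0 would cover the
  naturals.\<close>

lemma run_density_positive:
  assumes T: "T \<subseteq> {..<N}" and y: "y \<in> code_shift T"
  shows "\<exists>j\<in>T. 0 < run_density j y"
proof (rule ccontr)
  assume "\<not> (\<exists>j\<in>T. 0 < run_density j y)"
  then have zero: "run_density j y = 0" if "j \<in> T" for j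
    using run_density_nonneg[of j y] that by force
  have fin: "finite T" by (rule finite_subset[OF T]) simp
  obtain p where p: "code_walk T p" "y = (\<lambda>i. arc_label (p i))"
    using y unfolding code_shift_def by blast
  have "UNIV \<subseteq> (\<Union>j\<in>T. {i. \<exists>t<5 * l + 2. i + t \<in> run_positions j y})"
  proof
    fix i :: nat
    obtain v s j where vsj: "p i = (v, s, j)" by (cases "p i")
    have j: "j < code_length s"
      using code_walk_arcs[OF p(1), of i] vsj by (auto simp: arcs_over_def)
    let ?d = "code_length s - j"
    have d: "?d < 5 * l + 2" using code_length_le[of s] by linarith
    obtain v' s' where next': "p (i + ?d) = (v', s', 0)"
      using code_walk_next_word[OF p(1) vsj j] by blast
    then have v': "v' \<in> T" using code_walk_arcs[OF p(1), of "i + ?d"] by (auto simp: arcs_over_def)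
    have "\<forall>t<3 * l + 1. y (i + ?d + t) = P v' ! ((0 + t) mod l)"
      unfolding p(2) using code_walk_run[OF T p(1) next'] l_pos by simp
    then have "i + ?d \<in> run_positions v' y" unfolding run_positions_def by blast
    then show "i \<in> (\<Union>j\<in>T. {i. \<exists>t<5 * l + 2. i + t \<in> run_positions j y})"
      using v' d by blast
  qed
  from udens_mono[OF this]
  have "1 \<le> udens (\<Union>j\<in>T. {i. \<exists>t<5 * l + 2. i + t \<in> run_positions j y})"
    unfolding udens_UNIV .
  also have "\<dots> \<le> (\<Sum>j\<in>T. udens {i. \<exists>t<5 * l + 2. i + t \<in> run_positions j y})"
    by (rule udens_UN[OF fin])
  also have "\<dots> \<le> (\<Sum>j\<in>T. real (5 * l + 2) * run_density j y)"
    unfolding run_density_def by (intro sum_mono udens_prethicken)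
  also have "\<dots> = 0" using zero by simp
  finally show False by simp
qed

text \<open>Each prefix of a point is a factor of a concatenation of return words followed by
  \<open>w\<close>, and membership in a subshift is decided by prefixes.\<close>

lemma code_shift_subset:
  assumes X: "subshift X" and w: "occurs_in w X"
    "\<And>u v. occurs_in (u @ w) X \<Longrightarrow> occurs_in (w @ v) X \<Longrightarrow> occurs_in (u @ w @ v) X"
    and ret: "\<And>j. j < N \<Longrightarrow> P j \<in> return_words w X" "q \<in> return_words w X"
    and T: "T \<subseteq> {..<N}"
  shows "code_shift T \<subseteq> X"
proof
  fix y assume "y \<in> code_shift T"
  then obtain p where p: "code_walk T p" "y = (\<lambda>i. arc_label (p i))"
    unfolding code_shift_def by blast
  have arc: "v < N \<and> j < code_length s" if "p n = (v, s, j)" for n v s j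
    using code_walk_arcs[OF p(1), of n] that T by (auto simp: arcs_over_def)
  obtain v0 s0 j0 where p0: "p 0 = (v0, s0, j0)" by (cases "p 0")
  \<comment> \<open>The walk may start in the middle of a code word; \<open>?u\<close> is the part
    of that word it has skipped.\<close>
  let ?u = "take j0 (code_word v0 s0)"
  have ex: "\<exists>rs v s j. set rs \<subseteq> return_words w X \<and> p n = (v, s, j) \<and>
      concat rs @ take j (code_word v s) = ?u @ map y [0..<n]" for n
  proof (induction n)
    case 0
    show ?case using p0 by (intro exI[of _ "[]"]) auto
  next
    case (Suc n)
    then obtain rs v s j where IH: "set rs \<subseteq> return_words w X" "p n = (v, s, j)"
      "concat rs @ take j (code_word v s) = ?u @ map y [0..<n]" by blast
    note vj = arc[OF IH(2)]
    have j: "j < length (code_word v s)" using vj by (simp add: length_code_word)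
    have yn: "y n = code_word v s ! j" using IH(2) by (simp add: p(2) arc_label_def)
    have "concat rs @ take (Suc j) (code_word v s) =
        (concat rs @ take j (code_word v s)) @ [code_word v s ! j]"
      by (simp add: take_Suc_conv_app_nth[OF j])
    also have "\<dots> = (?u @ map y [0..<n]) @ [y n]" by (simp only: IH(3) yn)
    finally have eq: "concat rs @ take (Suc j) (code_word v s) = ?u @ map y [0..<Suc n]" by simp
    have st: "((v, s, j), p (Suc n)) \<in> step T" by (rule code_walk_step[OF p(1) IH(2)])
    show ?case
    proof (cases "Suc j < code_length s")
      case True
      then show ?thesis using step_insideD[OF st] IH(1) eq by blast
    next
      case False
      then obtain v' s' where next': "p (Suc n) = (v', s', 0)" using step_nextD[OF st] by blast
      let ?rs = "rs @ [P v, P v, P v, P v, if s then q else P v]"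
      have "set ?rs \<subseteq> return_words w X" using IH(1) ret vj by auto
      moreover have "take (Suc j) (code_word v s) = code_word v s"
        using False vj by (simp add: length_code_word)
      then have "concat ?rs @ take 0 (code_word v' s') = ?u @ map y [0..<Suc n]"
        using eq by (simp add: code_word_def)
      ultimately show ?thesis using next' by blast
    qed
  qed
  show "y \<in> X"
  proof (rule subshift_memberI[OF X])
    fix n
    obtain rs v s j where rs: "set rs \<subseteq> return_words w X" "p n = (v, s, j)"
      "concat rs @ take j (code_word v s) = ?u @ map y [0..<n]" using ex by blast
    \<comment> \<open>Completing the code word in progress turns the letters read so far into a
      factor of a full concatenation.\<close>
    let ?rs = "rs @ [P v, P v, P v, P v, if s then q else P v]"
    have "set ?rs \<subseteq> return_words w X" using rs(1) ret arc[OF rs(2)] by auto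
    then have occ: "occurs_in (concat ?rs @ w) X"
      using occurs_in_concat_return_words[of w X ?rs] w by blast
    have "concat ?rs = concat rs @ code_word v s" by (simp add: code_word_def)
    also have "\<dots> = (concat rs @ take j (code_word v s)) @ drop j (code_word v s)"
      by (simp only: append_assoc append_take_drop_id)
    also have "\<dots> = (?u @ map y [0..<n]) @ drop j (code_word v s)" by (simp only: rs(3))
    finally have "concat ?rs @ w = ?u @ map y [0..<n] @ drop j (code_word v s) @ w"
      by (simp only: append_assoc)
    with occ show "occurs_in (map y [0..<n]) X" by (simp only: occurs_in_factor)
  qed
qed

end

section \<open>Marker codes inside a mixing sofic shift of positive entropy\<close>

lemma marker_code_exists:
  fixes X :: "(nat \<Rightarrow> 'a::finite) set"
  assumes X: "sofic_shift X" "mixing X" "entropy X > 0"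
  obtains l P q where "marker_code N l P q"
    "\<And>T. T \<subseteq> {..<N} \<Longrightarrow> marker_code.code_shift l P q T \<subseteq> X"
proof -
  have ne: "X \<noteq> {}" using X(2) by (simp add: mixing_def)
  obtain w where w: "occurs_in w X"
    "\<And>u v. occurs_in (u @ w) X \<Longrightarrow> occurs_in (w @ v) X \<Longrightarrow> occurs_in (u @ w @ v) X"
    by (rule sofic_synchronizing_word[OF X(1) ne]) (rule that)
  obtain C where C: "\<And>n. C \<le> n \<Longrightarrow> \<exists>r\<in>return_words w X. length r = n"
    "\<And>n. card {u. length u = n \<and> occurs_in u X} \<le> card {r \<in> return_words w X. length r = n + C}"
    by (rule mixing_return_words[OF X(2) w(1)]) (rule that)
  \<comment> \<open>This many words of length \<open>n\<close> yield \<open>N * (n + C)\<close>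
    return words of length \<open>n + C\<close>, enough for \<open>N\<close> rotation
    classes.\<close>
  obtain n where n: "1 \<le> n" "N * (n + C) < card {w. length w = n \<and> occurs_in w X}"
    using positive_entropy_many_words[OF X(3)] by blast
  let ?l = "n + C"
  let ?A = "{r \<in> return_words w X. length r = ?l}"
  have A: "finite ?A"
    by (rule finite_subset[OF _ finite_lists_length_eq[of UNIV ?l]]) auto
  have card_A: "N * ?l \<le> card ?A" using n(2) C(2)[of n] by linarith
  have len_A: "length r = ?l" if "r \<in> ?A" for r using that by simp
  have l_pos: "0 < ?l" using n(1) by simp
  obtain P where P: "\<And>j. j < N \<Longrightarrow> P j \<in> ?A"
    "\<And>i j a b. i < N \<Longrightarrow> j < N \<Longrightarrow> rotate a (P i) = rotate b (P j) \<Longrightarrow> i = j"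
    by (rule rotation_classes[OF A len_A card_A l_pos]) (assumption, rule that)
  \<comment> \<open>Return words exist in every length from \<open>C\<close> on, in particular one
    letter longer than the \<open>P j\<close>.\<close>
  obtain q where q: "q \<in> return_words w X" "length q = ?l + 1" using C(1)[of "?l + 1"] by auto
  interpret marker_code N ?l P q
    using n(1) P q(2) by unfold_locales auto
  show ?thesis
  proof (rule that)
    show "marker_code N ?l P q" by (rule marker_code_axioms)
    have "subshift X" using X(1) unfolding sofic_shift_def by blast
    then show "code_shift T \<subseteq> X" if "T \<subseteq> {..<N}" for T
    proof (rule code_shift_subset[OF _ w])
      show "P j \<in> return_words w X" if "j < N" for j using P(1)[OF that] by simp
    qed (use q(1) that in simp_all)
  qed
qed

theorem theorem3:
  fixes X :: "(nat \<Rightarrow> 'a::finite) set"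
    and V :: "'v set" and K :: "'v set set"
    and f :: "'v \<Rightarrow> 'e::euclidean_space"
  assumes "sofic_shift X" and "mixing X" and "entropy X > 0"
    and "abstract_simplicial_complex V K" and "vertex_placement V f"
  shows "\<exists>Y. sofic_shift Y \<and> Y \<subseteq> X \<and>
    subtopology besicovitch_topology (besicovitch_saturation Y)
      homotopy_equivalent_space top_of_set (geometric_realization f K)"
proof -
  have V: "finite V" and K: "K \<subseteq> Pow V"
    using assms(4) unfolding abstract_simplicial_complex_def by auto
  \<comment> \<open>Numbering the vertices turns simplices into sets of naturals, which serve as
    indices of the marker words.\<close>
  obtain e where e: "bij_betw e {..<card V} V"
    using ex_bij_betw_nat_finite[OF V] by (auto simp: atLeast0LessThan)
  define N where "N = card V"
  define F where "F = f \<circ> e"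
  \<comment> \<open>The empty simplex, if present, is harmless: its coded shift has no walks and its
    hull is empty.\<close>
  define \<T> where "\<T> = {T. T \<subseteq> {..<N} \<and> e ` T \<in> K}"
  have inj_e: "inj_on e {..<N}" and img_e: "e ` {..<N} = V"
    using e unfolding N_def bij_betw_def by auto
  have F: "inj_on F {..<N}" "independent (F ` {..<N})"
    using assms(5) inj_e img_e unfolding F_def vertex_placement_def image_comp[symmetric]
    by (auto intro: comp_inj_on)
  obtain l P q where code: "marker_code N l P q"
    "\<And>T. T \<subseteq> {..<N} \<Longrightarrow> marker_code.code_shift l P q T \<subseteq> X"
    using marker_code_exists[OF assms(1-3)] by blast
  interpret marker_code N l P q by (rule code(1))
  let ?Y = "\<Union>T\<in>\<T>. code_shift T"
  have fam: "\<T> \<subseteq> Pow {..<N}" by (auto simp: \<T>_def)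
  have "(\<Union>T\<in>\<T>. convex hull (F ` T)) = geometric_realization f K"
  proof -
    have "K = (`) e ` \<T>"
    proof
      show "K \<subseteq> (`) e ` \<T>"
      proof
        fix S assume S: "S \<in> K"
        then have "S \<subseteq> e ` {..<N}" using K img_e by blast
        then obtain T where "T \<subseteq> {..<N}" "S = e ` T" by (auto simp: subset_image_iff)
        then show "S \<in> (`) e ` \<T>" using S by (auto simp: \<T>_def)
      qed
    qed (auto simp: \<T>_def)
    then have "geometric_realization f K = (\<Union>T\<in>\<T>. convex hull (f ` e ` T))"
      unfolding geometric_realization_def by simp
    then show ?thesis by (simp add: F_def image_comp)
  qed
  moreover have "subtopology besicovitch_topology (besicovitch_saturation ?Y)
      homotopy_equivalent_space top_of_set (\<Union>T\<in>\<T>. convex hull (F ` T))"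
  proof (rule homotopy_equivalent_realization[OF fam F])
    show "(\<lambda>i. code_word j False ! (i mod code_length False)) \<in> code_shift T" if "j \<in> T" for T j
      using that by (rule periodic_in_code_shift)
    show "\<exists>r\<in>code_shift T. bdist r (\<lambda>i. P' (\<sigma> i) i) = 0"
      if "\<And>k. P' k \<in> code_shift T" "udens {i. \<sigma> i \<noteq> \<sigma> (Suc i)} = 0"
      for T P' and \<sigma> :: "nat \<Rightarrow> nat"
      using that by (rule code_shift_glue)
    show "run_density j y = 0" if "T \<in> \<T>" "j < N" "j \<notin> T" "y \<in> code_shift T" for T j y
      using that fam by (intro run_density_outside) auto
    show "\<exists>j\<in>T. 0 < run_density j y" if "T \<in> \<T>" "y \<in> code_shift T" for T y
      using that fam by (intro run_density_positive) auto
  qed (rule run_density_lipschitz run_density_nonneg)+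
  moreover have "sofic_shift ?Y"
  proof (rule sofic_Union_code_shift)
    show "finite \<T>" by (rule finite_subset[OF fam]) simp
    show "finite T" if "T \<in> \<T>" for T
      using that fam by (auto intro: finite_subset[of _ "{..<N}"])
  qed
  moreover have "?Y \<subseteq> X" using code(2) fam by blast
  ultimately show ?thesis by auto
qed

end
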